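(* Let $\Lambda_k=\Lambda_k(\Delta_\infty)$ be the Krasnoselskii variational $\infty$-eigenvalues of $G$ and $R_k$ the $k$-th packing radius of $G$. Then $$\Lambda_k\le\frac1{R_k}\qquad\text{for all } k=1,\dots,|V_I|,$$ and equality holds for $k=1,2$.
   Context: $G=(V,E,\omega)$ is a finite undirected weighted graph: $E\subset V\times V$ is symmetric and $\omega_{uv}=\omega_{vu}>0$ for $(u,v)\in E$; $u\sim v$ means $(u,v)\in E$. $B\subset V$ (possibly empty) is the boundary and $V_I=V\setminus B\neq\emptyset$ the set of internal nodes. $G$ is connected: if $B=\emptyset$ any two nodes are joined by a path; if $B\ne\emptyset$ the subgraph induced by $V_I$ is connected and at least one internal node is adjacent to $B$. $\mathcal H_0(V)=\{f:V\to\mathbb R:\ f=0 \text{ on } B\}$. The length of a path $v_0\sim v_1\sim\dots\sim v_n$ is $\sum_{i=1}^n\omega_{v_{i-1}v_i}^{-1}$; $d(u,v)$ is the minimal length of a path joining $u$ and $v$ (so $d(u,u)=0$), and $d_B(u)=\min_{v\in B}d(u,v)$, with $d_B\equiv+\infty$ if $B=\emptyset$. The $k$-th packing radius is $R_k=\max\{r>0:\ \exists\,u_1,\dots,u_k\in V_I \text{ with } d(u_i,u_j)\ge 2r \text{ for all } i\neq j \text{ and } d_B(u_i)\ge r \text{ for all } i\}$ (if $B=\emptyset$ and $k=1$, then $R_1=+\infty$ and $1/R_1=0$). For $f\in\mathcal H_0(V)$: $\nabla f(u,v)=\omega_{uv}(f(v)-f(u))$, $\|f\|_\infty=\max_{u\in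 V}|f(u)|$, $\|\nabla f\|_\infty=\max_{(u,v)\in E}|\nabla f(u,v)|$ (a maximum over the empty set is $0$), $\mathcal R_\infty(f)=\|\nabla f\|_\infty/\|f\|_\infty$ for $f\neq0$, $S_\infty=\{f\in\mathcal H_0(V):\|f\|_\infty=1\}$. The Krasnoselskii variational $\infty$-eigenvalues are $\Lambda_k(\Delta_\infty)=\min_{A\in\mathcal F_k(S_\infty)}\max_{f\in A}\mathcal R_\infty(f)$, where $\mathcal F_k(S_\infty)$ is the family of closed symmetric ($A=-A$) subsets of $S_\infty$ with Krasnoselskii genus at least $k$. The genus of a closed symmetric set $A$ is $0$ if $A=\emptyset$, otherwise the least $h\in\mathbb N$ for which there is a continuous odd map $A\to\mathbb R^h\setminus\{0\}$ ($\infty$ if there is none). Equality for $k=2$ is understood when $|V_I|\ge2$. *)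

theory Defs
  imports "HOL-Analysis.Analysis"
begin

text \<open>
  Minima and maxima are rendered by \<open>LEAST\<close> and \<open>GREATEST\<close> rather than by \<open>Inf\<close> and \<open>Sup\<close>,
  so that a statement about one of these values is only provable if the value is attained.
\<close>

definition node_path :: "('a \<times> 'a) set \<Rightarrow> 'a \<Rightarrow> 'a list \<Rightarrow> 'a \<Rightarrow> bool" where
  "node_path E u xs v \<longleftrightarrow> xs \<noteq> [] \<and> hd xs = u \<and> last xs = v \<and> successively (\<lambda>x y. (x, y) \<in> E) xs"

definition connected_within :: "('a \<times> 'a) set \<Rightarrow> 'a set \<Rightarrow> bool" where
  "connected_within E S \<longleftrightarrow> (\<forall>u\<in>S. \<forall>v\<in>S. \<exists>xs. set xs \<subseteq> S \<and> node_path E u xs v)"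

locale weighted_graph =
  fixes V :: "'a set" and E :: "('a \<times> 'a) set" and \<omega> :: "'a \<Rightarrow> 'a \<Rightarrow> real" and B :: "'a set"
  assumes finite_V: "finite V"
    and E_subset: "E \<subseteq> V \<times> V"
    and sym_E: "sym E"
    and weight_sym: "(u, v) \<in> E \<Longrightarrow> \<omega> u v = \<omega> v u"
    and weight_pos: "(u, v) \<in> E \<Longrightarrow> \<omega> u v > 0"
    and B_subset: "B \<subseteq> V"
    and internal_nonempty: "V - B \<noteq> {}"
    and connected_no_boundary: "B = {} \<Longrightarrow> connected_within E V"
    and connected_internal: "B \<noteq> {} \<Longrightarrow> connected_within E (V - B)"
    and adjacent_boundary: "B \<noteq> {} \<Longrightarrow> \<exists>u\<in>V - B. \<exists>v\<in>B. (u, v) \<in> E"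
begin

definition path_length :: "'a list \<Rightarrow> real" where
  "path_length xs = (\<Sum>i<length xs - 1. inverse (\<omega> (xs ! i) (xs ! Suc i)))"

text \<open>
  A node of \<open>B\<close> need not be joined to the internal nodes, whence the value \<open>\<infinity>\<close>.
\<close>

definition dist_G :: "'a \<Rightarrow> 'a \<Rightarrow> ereal" where
  "dist_G u v =
    (if \<exists>xs. node_path E u xs v then ereal (LEAST l. \<exists>xs. node_path E u xs v \<and> l = path_length xs) else \<infinity>)"

definition dist_B :: "'a \<Rightarrow> ereal" where
  "dist_B u = (if B = {} then \<infinity> else Min (dist_G u ` B))"

definition packable :: "nat \<Rightarrow> real \<Rightarrow> bool" where
  "packable k r \<longleftrightarrow>
    (\<exists>u. (\<forall>i\<in>{1..k}. u i \<in> V - B) \<and>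
         (\<forall>i\<in>{1..k}. \<forall>j\<in>{1..k}. i \<noteq> j \<longrightarrow> dist_G (u i) (u j) \<ge> ereal (2 * r)) \<and>
         (\<forall>i\<in>{1..k}. dist_B (u i) \<ge> ereal r))"

definition packing_radius :: "nat \<Rightarrow> ereal" where
  "packing_radius k =
    (if B = {} \<and> k = 1 then \<infinity> else ereal (GREATEST r. r > 0 \<and> packable k r))"

text \<open>
  Functions on \<open>V\<close> are represented by functions on the whole type that vanish outside \<open>V\<close>.
  As \<open>V\<close> is finite, the product topology of the type \<open>'a \<Rightarrow> real\<close> induces on this subspace
  the Euclidean topology.
\<close>

definition H0 :: "('a \<Rightarrow> real) set" where
  "H0 = {f. (\<forall>u\<in>B. f u = 0) \<and> (\<forall>u. u \<notin> V \<longrightarrow> f u = 0)}"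

definition grad :: "('a \<Rightarrow> real) \<Rightarrow> 'a \<Rightarrow> 'a \<Rightarrow> real" where
  "grad f u v = \<omega> u v * (f v - f u)"

definition norm_inf :: "('a \<Rightarrow> real) \<Rightarrow> real" where
  "norm_inf f = Max ((\<lambda>u. \<bar>f u\<bar>) ` V)"

definition grad_norm_inf :: "('a \<Rightarrow> real) \<Rightarrow> real" where
  "grad_norm_inf f = (if E = {} then 0 else Max ((\<lambda>(u, v). \<bar>grad f u v\<bar>) ` E))"

definition rayleigh_inf :: "('a \<Rightarrow> real) \<Rightarrow> real" where
  "rayleigh_inf f = grad_norm_inf f / norm_inf f"

definition S_inf :: "('a \<Rightarrow> real) set" where
  "S_inf = {f \<in> H0. norm_inf f = 1}"

end

text \<open>
  \<open>Euclidean_space h\<close> is \<open>\<real>\<^sup>h\<close>, realized as the sequences vanishing from index \<open>h\<close> on.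
\<close>

definition odd_map_to :: "('a \<Rightarrow> real) set \<Rightarrow> nat \<Rightarrow> (('a \<Rightarrow> real) \<Rightarrow> nat \<Rightarrow> real) \<Rightarrow> bool" where
  "odd_map_to A h \<phi> \<longleftrightarrow>
    continuous_map (top_of_set A) (subtopology (Euclidean_space h) (- {\<lambda>_. 0})) \<phi> \<and>
    (\<forall>f\<in>A. \<phi> (- f) = - \<phi> f)"

definition genus :: "('a \<Rightarrow> real) set \<Rightarrow> enat" where
  "genus A =
    (if A = {} then 0
     else if \<exists>h \<phi>. odd_map_to A h \<phi> then enat (LEAST h. \<exists>\<phi>. odd_map_to A h \<phi>)
     else \<infinity>)"

context weighted_graph
begin

text \<open>
  \<open>S_inf\<close> is closed in \<open>'a \<Rightarrow> real\<close>, so closedness in \<open>S_inf\<close> and in the type agree.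
\<close>

definition genus_family :: "nat \<Rightarrow> ('a \<Rightarrow> real) set set" where
  "genus_family k = {A. A \<subseteq> S_inf \<and> closed A \<and> uminus ` A = A \<and> genus A \<ge> enat k}"

definition max_rayleigh :: "('a \<Rightarrow> real) set \<Rightarrow> real" where
  "max_rayleigh A = (GREATEST r. \<exists>f\<in>A. r = rayleigh_inf f)"

definition Lambda :: "nat \<Rightarrow> real" where
  "Lambda k = (LEAST l. \<exists>A\<in>genus_family k. l = max_rayleigh A)"

end

end

theory Submission
  imports Defs "HOL-Homology.Brouwer_Degree"
begin

text \<open>
  Both inequalities compare levels of the gradient norm with radii. On the unit sphere \<open>S_inf\<close> the
  Rayleigh quotient is the gradient norm, so everything is expressed by the sublevel sets
  \<open>sublevel c\<close> of the functions of sup norm one whose gradient is at most \<open>c\<close>.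

  \<^emph>\<open>The minimum exists\<close> (\<open>Lambda_attained\<close>). Every set that competes in the definition of
  \<open>Lambda k\<close> lies in the sublevel set of its own maximum, so only sublevel sets matter, and \<open>Lambda k\<close> is
  the least \<open>c\<close> for which \<open>sublevel c\<close> has genus at least \<open>k\<close>. That the infimum of these \<open>c\<close> is itself
  such a level follows from compactness: an odd map without zeros on \<open>sublevel c\<close> extends by Tietze to
  an odd map on \<open>S_inf\<close>, and on the compact set of zeros of the extension the gradient norm exceeds
  \<open>c\<close> by a fixed amount (\<open>genus_sublevel_upper_semicontinuous\<close>).

  \<^emph>\<open>Upper bound\<close> (\<open>Lambda_le_packing\<close>). Centres \<open>u\<^sub>1, \<dots>, u\<^sub>k\<close> of a packing of radius \<open>r\<close> carry the tents
  \<open>max 0 (1 - d(u\<^sub>i, x) / r)\<close>. They vanish on the boundary, and no node lies in two of their supports.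
  Therefore a combination of them whose largest coefficient is \<open>1\<close> in absolute value has sup norm \<open>1\<close>,
  and its gradient is at most \<open>1 / r\<close>, also across an edge that joins two different supports. This
  is an odd image of the \<open>(k - 1)\<close>-sphere inside \<open>sublevel (1 / r)\<close>, which by the theorem of Borsuk and
  Ulam has genus at least \<open>k\<close>.

  \<^emph>\<open>Lower bounds\<close> (\<open>Lambda_1_ge\<close>, \<open>Lambda_2_ge\<close>). Along a walk of length \<open>l\<close> a function changes by at
  most \<open>l\<close> times its gradient norm. A node where \<open>\<bar>f\<bar> = 1\<close> thus has distance at least the inverse
  of the gradient norm from the boundary, and a node where \<open>f = 1\<close> has at least twice that distance
  from a node where \<open>f = -1\<close>. Every set of genus at least two contains an \<open>f\<close> with both values: otherwise
  \<open>max f + min f\<close> would be an odd real function without zeros on it.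

  \<^emph>\<open>Borsuk-Ulam\<close> (\<open>Borsuk_Ulam_nsphere\<close>). As the homology of the sphere vanishes below its dimension,
  there are chains \<open>h\<^sub>p\<close>, one in each dimension up to that of the sphere, which behave like the
  hemispheres: \<open>h\<^sub>0\<close> is a point, and the boundary of \<open>h\<^sub>p\<close> consists of \<open>h\<close> in dimension \<open>p - 1\<close> and its
  antipode. On the other side stands the cup product of the coboundaries of \<open>p\<close> antipodally
  complementary \<open>{0,1}\<close>-valued functions. Its value on \<open>h\<^sub>p\<close> is odd for purely algebraic reasons. If an
  odd map to \<open>\<real>\<^sup>p\<close> had no zero, one could take the signs of its components; each small simplex lies where
  some component has constant sign, so that the product would vanish on a fine subdivision of \<open>h\<^sub>p\<close>.
\<close>

section \<open>The Borsuk-Ulam theorem\<close>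

text \<open>
  The pairing of an integer cochain with a singular chain. Passing through the free abelian group on
  one generator makes it additive by the laws of \<open>frag_extend\<close>.
\<close>

definition cochain_eval :: "(((nat \<Rightarrow> real) \<Rightarrow> 'a) \<Rightarrow> int) \<Rightarrow> 'a chain \<Rightarrow> int" where
  "cochain_eval \<phi> c = Poly_Mapping.lookup (frag_extend (\<lambda>\<sigma>. frag_cmul (\<phi> \<sigma>) (frag_of ())) c) ()"

lemma cochain_eval_zero [simp]: "cochain_eval \<phi> 0 = 0"
  by (simp add: cochain_eval_def)

lemma cochain_eval_of [simp]: "cochain_eval \<phi> (frag_of \<sigma>) = \<phi> \<sigma>"
  by (simp add: cochain_eval_def)

lemma cochain_eval_add: "cochain_eval \<phi> (a + b) = cochain_eval \<phi> a + cochain_eval \<phi> b"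
  by (simp add: cochain_eval_def frag_extend_add lookup_add)

lemma cochain_eval_diff: "cochain_eval \<phi> (a - b) = cochain_eval \<phi> a - cochain_eval \<phi> b"
  by (simp add: cochain_eval_def frag_extend_diff lookup_minus)

lemma cochain_eval_cmul: "cochain_eval \<phi> (frag_cmul k c) = k * cochain_eval \<phi> c"
  by (simp add: cochain_eval_def frag_extend_cmul)

lemma cochain_eval_sum: "cochain_eval \<phi> (sum g I) = (\<Sum>i\<in>I. cochain_eval \<phi> (g i))"
  by (induction I rule: infinite_finite_induct) (auto simp: cochain_eval_add)

lemma cochain_eval_eq_0:
  assumes "\<And>\<sigma>. \<sigma> \<in> Poly_Mapping.keys c \<Longrightarrow> \<phi> \<sigma> = 0"
  shows "cochain_eval \<phi> c = 0"
  using assms by (simp add: cochain_eval_def frag_extend_eq_0)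

lemma cochain_eval_chain_map:
  "cochain_eval \<phi> (chain_map p g c) = cochain_eval (\<lambda>\<sigma>. \<phi> (simplex_map p g \<sigma>)) c"
proof -
  have "Poly_Mapping.keys c \<subseteq> UNIV" by simp
  then show ?thesis
    by (induction c rule: frag_induction) (auto simp: chain_map_diff cochain_eval_diff)
qed

lemma cochain_eval_lincomb:
  assumes "singular_chain p X c"
    and "\<And>\<sigma>. singular_simplex p X \<sigma> \<Longrightarrow> \<phi> \<sigma> = a * \<psi> \<sigma> + b * \<theta> \<sigma>"
  shows "cochain_eval \<phi> c = a * cochain_eval \<psi> c + b * cochain_eval \<theta> c"
  using assms(1) unfolding singular_chain_def
  by (induction c rule: frag_induction) (auto simp: cochain_eval_diff assms(2) algebra_simps)

abbreviation simplex_vertex :: "nat \<Rightarrow> nat \<Rightarrow> real" where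
  "simplex_vertex i \<equiv> (\<lambda>j. if j = i then 1 else 0)"

text \<open>
  This is the cup product of the coboundaries of the 0-cochains \<open>s 0, \<dots>, s (p - 1)\<close>, evaluated on a
  singular simplex by the Alexander-Whitney formula.
\<close>

definition cup_flips :: "(nat \<Rightarrow> 'a \<Rightarrow> int) \<Rightarrow> nat \<Rightarrow> ((nat \<Rightarrow> real) \<Rightarrow> 'a) \<Rightarrow> int" where
  "cup_flips s p \<sigma> = (\<Prod>i<p. s i (\<sigma> (simplex_vertex (Suc i))) - s i (\<sigma> (simplex_vertex i)))"

lemma vertex_singular_face:
  assumes "i \<le> p" "k \<le> Suc p"
  shows "singular_face (Suc p) k \<sigma> (simplex_vertex i) = \<sigma> (simplex_vertex (if i < k then i else Suc i))"
proof -
  have "simplical_face k (simplex_vertex i) = simplex_vertex (if i < k then i else Suc i)"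
    using assms by (auto simp: simplical_face_def fun_eq_iff)
  then show ?thesis
    using assms by (simp add: singular_face_def)
qed

text \<open>
  The product with index \<open>k\<close> splits at its factor \<open>x k + y k\<close> into two mixed products, one with \<open>k\<close> and
  one with \<open>k + 1\<close> leading \<open>x\<close>'s. In the alternating sum the mixed products cancel in pairs. The index
  \<open>k = p\<close> stands for the product of all the \<open>x\<close>'s, so that only the product of the \<open>y\<close>'s remains.
\<close>

lemma alternating_sum_telescope:
  fixes x y :: "nat \<Rightarrow> int"
  shows "(\<Sum>k\<le>p. (-1) ^ k * (\<Prod>i<p. if i < k then x i else if i = k then x i + y i else y i)) = (\<Prod>i<p. y i)"
proof (induction p)
  case (Suc p)
  define W where "W = (\<lambda>p k. \<Prod>i<p. if i < k then x i else if i = k then x i + y i else y i)"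
  have 1: "W (Suc p) k = W p k * y p" if "k < p" for k
    using that by (simp add: W_def)
  have 2: "W (Suc p) p = W p p * (x p + y p)" 
    by (simp add: W_def)
  have 3: "W (Suc p) (Suc p) = W p p * x p" 
    by (simp add: W_def)
  have "(\<Sum>k\<le>Suc p. (-1) ^ k * W (Suc p) k) = 
        (\<Sum>k<p. (-1) ^ k * W (Suc p) k) + (-1) ^ p * W (Suc p) p - (-1) ^ p * W (Suc p) (Suc p)"
    by (simp add: lessThan_Suc_atMost [symmetric])
  also have "\<dots> = (\<Sum>k<p. (-1) ^ k * W p k) * y p + (-1) ^ p * W p p * y p"
    by (simp add: 1 2 3 sum_distrib_right sum_distrib_left algebra_simps)
  also have "\<dots> = (\<Sum>k\<le>p. (-1) ^ k * W p k) * y p"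
    by (simp add: lessThan_Suc_atMost [symmetric] algebra_simps)
  finally show ?case
    using Suc.IH by (simp add: W_def)
qed simp

text \<open>
  The Leibniz rule for \<open>s 0 \<union> \<delta>(s 1) \<union> \<dots> \<union> \<delta>(s p)\<close>, in which all terms but the first vanish because
  \<open>\<delta>\<delta> = 0\<close>. Omitting a vertex between two factors merges two successive differences into their sum,
  which is the pattern of the telescoping identity above.
\<close>

lemma cup_flips_coboundary_simplex:
  "(\<Sum>k\<le>Suc p. (-1) ^ k * (s 0 (singular_face (Suc p) k \<sigma> (simplex_vertex 0)) *
      cup_flips (\<lambda>i. s (Suc i)) p (singular_face (Suc p) k \<sigma>))) = cup_flips s (Suc p) \<sigma>"
proof -
  define b where "b = (\<lambda>i j. s i (\<sigma> (simplex_vertex j)))"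
  define x y where "x = (\<lambda>i. b (Suc i) (Suc i) - b (Suc i) i)" 
    and "y = (\<lambda>i. b (Suc i) (Suc (Suc i)) - b (Suc i) (Suc i))"
  define G where "G = (\<lambda>k. s 0 (singular_face (Suc p) k \<sigma> (simplex_vertex 0)) *
      cup_flips (\<lambda>i. s (Suc i)) p (singular_face (Suc p) k \<sigma>))"
  have G: "G k = b 0 (if k = 0 then 1 else 0) * 
      (\<Prod>i<p. b (Suc i) (if Suc i < k then Suc i else Suc (Suc i)) - b (Suc i) (if i < k then i else Suc i))"
    if "k \<le> Suc p" for k
    using that by (simp add: G_def cup_flips_def vertex_singular_face b_def)
  have G0: "G 0 = b 0 1 * (\<Prod>i<p. y i)"
    by (simp add: G y_def)
  have GS: "G (Suc k) = b 0 0 * (\<Prod>i<p. if i < k then x i else if i = k then x i + y i else y i)"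
    if "k \<le> p" for k
  proof -
    have "(\<Prod>i<p. b (Suc i) (if i < k then Suc i else Suc (Suc i)) - b (Suc i) (if i < Suc k then i else Suc i))
       = (\<Prod>i<p. if i < k then x i else if i = k then x i + y i else y i)"
      by (rule prod.cong) (auto simp: x_def y_def)
    then show ?thesis
      using that by (simp add: G)
  qed
  have "(\<Sum>k\<le>Suc p. (-1) ^ k * G k) = G 0 - (\<Sum>k\<le>p. (-1) ^ k * G (Suc k))"
    by (subst sum.atMost_Suc_shift) (simp add: sum_negf)
  also have "(\<Sum>k\<le>p. (-1) ^ k * G (Suc k)) = b 0 0 * (\<Prod>i<p. y i)"
    by (subst alternating_sum_telescope [where x = x and y = y, symmetric])
       (simp add: GS sum_distrib_left algebra_simps)
  also have "G 0 - b 0 0 * (\<Prod>i<p. y i) = (b 0 1 - b 0 0) * (\<Prod>i<p. y i)"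
    by (simp add: G0 algebra_simps)
  also have "\<dots> = cup_flips s (Suc p) \<sigma>"
    unfolding cup_flips_def prod.lessThan_Suc_shift by (simp add: b_def y_def)
  finally show ?thesis
    unfolding G_def .
qed

lemma cup_flips_coboundary:
  "cochain_eval (\<lambda>\<sigma>. s 0 (\<sigma> (simplex_vertex 0)) * cup_flips (\<lambda>i. s (Suc i)) p \<sigma>) (chain_boundary (Suc p) c)
   = cochain_eval (cup_flips s (Suc p)) c"
proof -
  have "Poly_Mapping.keys c \<subseteq> UNIV" by simp
  then show ?thesis
  proof (induction c rule: frag_induction)
    case (one \<sigma>)
    show ?case
      using cup_flips_coboundary_simplex [of s p \<sigma>]
      by (simp add: chain_boundary_of cochain_eval_add cochain_eval_sum cochain_eval_cmul)
  next
    case (diff a b)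
    then show ?case by (simp add: chain_boundary_diff cochain_eval_diff)
  qed simp
qed

text \<open>
  The chains \<open>h p\<close> generalize the hemispheres of dimension \<open>p\<close> of a sphere with antipodal map \<open>\<tau>\<close>. The
  sign is forced: it makes the right-hand side of the boundary formula a cycle.
\<close>

definition antipodal_chains ::
  "'a topology \<Rightarrow> ('a \<Rightarrow> 'a) \<Rightarrow> nat \<Rightarrow> (nat \<Rightarrow> 'a chain) \<Rightarrow> bool" where
  "antipodal_chains X \<tau> n h \<longleftrightarrow>
    (\<exists>\<sigma>. h 0 = frag_of \<sigma>) \<and>
    (\<forall>p\<le>n. singular_chain p X (h p)) \<and>
    (\<forall>p<n. chain_boundary (Suc p) (h (Suc p)) = h p + frag_cmul ((-1) ^ Suc p) (chain_map p \<tau> (h p)))"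

text \<open>
  By the Leibniz rule the value on \<open>h (Suc p)\<close> equals the value of \<open>s 0 \<union> \<kappa>\<close> on the boundary, where \<open>\<kappa>\<close> is
  the product of the remaining coboundaries. Applying \<open>\<tau>\<close> replaces \<open>s 0\<close> by \<open>1 - s 0\<close> and changes \<open>\<kappa>\<close> only by
  a sign, so the two halves of the boundary contribute modulo two the value of \<open>\<kappa>\<close> on \<open>h p\<close>.
  The chain \<open>h 0\<close> is a single point, on which the empty product is \<open>1\<close>. The induction needs all families
  \<open>s\<close> at once because it drops the first member.
\<close>

lemma odd_cup_flips_antipodal_chains:
  assumes h: "antipodal_chains X \<tau> n h"
    and s: "\<And>i x. x \<in> topspace X \<Longrightarrow> s i (\<tau> x) = 1 - s i x" 
    and "p \<le> n"
  shows "odd (cochain_eval (cup_flips s p) (h p))"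
  using s \<open>p \<le> n\<close>
proof (induction p arbitrary: s)
  case 0
  then show ?case
    using h by (auto simp: antipodal_chains_def cup_flips_def)
next
  case (Suc p)
  define s' where "s' = (\<lambda>i. s (Suc i))"
  define \<psi> where "\<psi> = (\<lambda>\<sigma>. s 0 (\<sigma> (simplex_vertex 0)) * cup_flips s' p \<sigma>)"
  have hp: "singular_chain p X (h p)"
    using h Suc.prems by (simp add: antipodal_chains_def)
  have vx: "simplex_map p \<tau> \<sigma> (simplex_vertex i) = \<tau> (\<sigma> (simplex_vertex i))"
     "\<sigma> (simplex_vertex i) \<in> topspace X"
    if "singular_simplex p X \<sigma>" "i \<le> p" for \<sigma> i
    using that by (auto simp: simplex_map_def singular_simplex_def continuous_map_def)
  have flip: "cup_flips s' p (simplex_map p \<tau> \<sigma>) = (-1) ^ p * cup_flips s' p \<sigma>"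
    if \<sigma>: "singular_simplex p X \<sigma>" for \<sigma>
  proof -
    have "cup_flips s' p (simplex_map p \<tau> \<sigma>) = 
       (\<Prod>i<p. - 1 * (s' i (\<sigma> (simplex_vertex (Suc i))) - s' i (\<sigma> (simplex_vertex i))))"
      unfolding cup_flips_def
      by (rule prod.cong) (use vx [OF \<sigma>] Suc.prems in \<open>auto simp: s'_def\<close>)
    also have "\<dots> = (-1) ^ p * cup_flips s' p \<sigma>"
      unfolding cup_flips_def prod.distrib by simp
    finally show ?thesis .
  qed
  have \<psi>\<tau>: "\<psi> (simplex_map p \<tau> \<sigma>) = (-1) ^ p * cup_flips s' p \<sigma> + (- ((-1) ^ p)) * \<psi> \<sigma>"
    if \<sigma>: "singular_simplex p X \<sigma>" for \<sigma>
  proof -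
    have s0: "s 0 (simplex_map p \<tau> \<sigma> (simplex_vertex 0)) = 1 - s 0 (\<sigma> (simplex_vertex 0))"
      using vx [OF \<sigma> le0] Suc.prems(1) by metis
    show ?thesis
      unfolding \<psi>_def flip [OF \<sigma>] s0 by (simp add: algebra_simps)
  qed
  have "cochain_eval (cup_flips s (Suc p)) (h (Suc p)) = cochain_eval \<psi> (chain_boundary (Suc p) (h (Suc p)))"
    unfolding \<psi>_def s'_def by (rule cup_flips_coboundary [symmetric])
  also have "\<dots> = cochain_eval \<psi> (h p) - (-1) ^ p * cochain_eval (\<lambda>\<sigma>. \<psi> (simplex_map p \<tau> \<sigma>)) (h p)"
    using h Suc.prems(2)
    by (simp add: antipodal_chains_def cochain_eval_add cochain_eval_diff cochain_eval_cmul cochain_eval_chain_map)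
  also have "cochain_eval (\<lambda>\<sigma>. \<psi> (simplex_map p \<tau> \<sigma>)) (h p)
     = (-1) ^ p * cochain_eval (cup_flips s' p) (h p) + (- ((-1) ^ p)) * cochain_eval \<psi> (h p)"
    by (rule cochain_eval_lincomb [OF hp \<psi>\<tau>])
  also have "cochain_eval \<psi> (h p) - (-1) ^ p * ((-1) ^ p * cochain_eval (cup_flips s' p) (h p) + 
      (- ((-1) ^ p)) * cochain_eval \<psi> (h p)) = 2 * cochain_eval \<psi> (h p) - cochain_eval (cup_flips s' p) (h p)"
  proof -
    have "(-1) ^ p * ((-1) ^ p * y + - ((-1) ^ p) * x) = ((-1) ^ p * (-1) ^ p) * (y - x)" for x y :: int
      by (simp only: algebra_simps)
    also have "((-1) ^ p * (-1) ^ p) * (y - x) = y - x" for x y :: int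
      by (simp flip: power_add)
    finally show ?thesis by simp
  qed
  finally have "cochain_eval (cup_flips s (Suc p)) (h (Suc p)) 
     = 2 * cochain_eval \<psi> (h p) - cochain_eval (cup_flips s' p) (h p)" .
  moreover have "odd (cochain_eval (cup_flips s' p) (h p))"
    by (rule Suc.IH) (use Suc.prems in \<open>auto simp: s'_def\<close>)
  ultimately show ?case by simp
qed

text \<open>
  Barycentric subdivision commutes with boundaries and with induced maps, and it fixes points.
\<close>

lemma antipodal_chains_subdivision:
  assumes h: "antipodal_chains X \<tau> n h" 
  shows "antipodal_chains X \<tau> n (\<lambda>p. (singular_subdivision p ^^ m) (h p))"
proof (induction m)
  case 0
  then show ?case using h by simp
next
  case (Suc m)
  define g where "g = (\<lambda>p. (singular_subdivision p ^^ m) (h p))"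
  have g: "antipodal_chains X \<tau> n g"
    using Suc by (simp add: g_def)
  have cmul: "singular_subdivision p (frag_cmul k c) = frag_cmul k (singular_subdivision p c)" for p k and c :: "'a chain"
    by (simp add: singular_subdivision_def frag_extend_cmul)
  have "antipodal_chains X \<tau> n (\<lambda>p. singular_subdivision p (g p))"
    unfolding antipodal_chains_def
  proof (intro conjI allI impI)
    show "\<exists>\<sigma>. singular_subdivision 0 (g 0) = frag_of \<sigma>"
      using g singular_subdivision_zero by (metis antipodal_chains_def le0)
    show "singular_chain p X (singular_subdivision p (g p))" if "p \<le> n" for p
      using g that by (simp add: antipodal_chains_def singular_chain_singular_subdivision)
    show "chain_boundary (Suc p) (singular_subdivision (Suc p) (g (Suc p))) = singular_subdivision p (g p) +
            frag_cmul ((- 1) ^ Suc p) (chain_map p \<tau> (singular_subdivision p (g p)))" if "p < n" for p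
    proof -
      have gp: "singular_chain p X (g p)" "singular_chain (Suc p) X (g (Suc p))"
        using g that by (auto simp: antipodal_chains_def)
      have "chain_boundary (Suc p) (g (Suc p)) = g p + frag_cmul ((-1) ^ Suc p) (chain_map p \<tau> (g p))"
        using g that by (simp add: antipodal_chains_def)
      then show ?thesis
        by (simp add: chain_boundary_singular_subdivision [OF gp(2)] singular_subdivision_add
            singular_subdivision_diff cmul naturality_singular_subdivision [OF gp(1)])
    qed
  qed
  then show ?case by (simp add: g_def)
qed

lemma continuous_map_nsphere_uminus:
  "continuous_map (nsphere n) (nsphere n) (uminus :: (nat \<Rightarrow> real) \<Rightarrow> _)"
  unfolding nsphere continuous_map_in_subtopology continuous_map_componentwise_UNIV fun_Compl_def
  by (auto intro!: continuous_intros continuous_map_from_subtopology continuous_map_product_projection)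

lemma nsphere_cycle_bounds:
  assumes p: "0 < p" "p < n" and c: "singular_chain p (nsphere n) c" "chain_boundary p c = 0"
  obtains d where "singular_chain (Suc p) (nsphere n) d" "chain_boundary (Suc p) d = c"
proof -
  have "trivial_group (homology_group (int p) (nsphere n))"
    using p reduced_homology_group_nsphere(2) [of "int p" n] by (simp add: un_reduced_homology_group)
  moreover have "homologous_rel_set p (nsphere n) {} c \<in> carrier (homology_group (int p) (nsphere n))"
    using c by (auto simp: carrier_relative_homology_group singular_cycle)
  ultimately have "homologous_rel_set p (nsphere n) {} c = singular_relboundary_set p (nsphere n) {}"
    by (simp add: trivial_group_def one_relative_homology_group)
  then have "singular_relboundary p (nsphere n) {} c"
    by (metis homologous_rel_refl mem_Collect_eq)
  then show thesis
    using that by (auto simp: singular_boundary)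
qed

text \<open>
  In dimension zero a chain bounds only if its coefficients cancel on path components. Here
  both points lie in the hemisphere where the last coordinate is nonnegative. It is contractible and
  hence path-connected.
\<close>

lemma antipodal_points_bound:
  assumes "0 < n" "singular_simplex 0 (nsphere n) \<sigma>" 
    and "\<sigma> (simplex_vertex 0) = simplex_vertex 0"
  obtains d where "singular_chain (Suc 0) (nsphere n) d" 
    "chain_boundary (Suc 0) d = frag_of \<sigma> - frag_of (simplex_map 0 uminus \<sigma>)"
proof -
  let ?Y = "subtopology (nsphere n) {x. x n \<ge> 0}"
  have "path_connected_space ?Y"
    by (simp add: contractible_imp_path_connected_space contractible_space_upper_hemisphere)
  moreover have "singular_simplex 0 ?Y \<sigma>" 
    using assms by (auto simp: singular_simplex_subtopology standard_simplex_0)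
  moreover have "singular_simplex 0 ?Y (simplex_map 0 uminus \<sigma>)" 
    using assms singular_simplex_simplex_map [OF assms(2) continuous_map_nsphere_uminus]
    by (auto simp: singular_simplex_subtopology standard_simplex_0 simplex_map_def)
  ultimately have "homologous_rel 0 ?Y {} (frag_of \<sigma>) (frag_of (simplex_map 0 uminus \<sigma>))"
    by (rule iso_integer_zeroth_homology_group_aux)
  then obtain d where "singular_chain (Suc 0) ?Y d" 
    "chain_boundary (Suc 0) d = frag_of \<sigma> - frag_of (simplex_map 0 uminus \<sigma>)"
    by (auto simp: homologous_rel_def singular_boundary)
  then show thesis
    using that by (auto simp: singular_chain_subtopology)
qed

text \<open>
  The next chain exists as soon as \<open>h m\<close> and its antipode together form a cycle, which the sign in the
  boundary formula ensures, and as the homology of the sphere vanishes in dimension \<open>m\<close>.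
\<close>

lemma antipodal_chains_nsphere:
  assumes \<sigma>: "singular_simplex 0 (nsphere n) \<sigma>" "\<sigma> (simplex_vertex 0) = simplex_vertex 0"
    and "m \<le> n"
  shows "\<exists>h. antipodal_chains (nsphere n) uminus m h \<and> h 0 = frag_of \<sigma>"
  using \<open>m \<le> n\<close>
proof (induction m)
  case 0
  then show ?case
    using \<sigma> by (intro exI [of _ "\<lambda>_. frag_of \<sigma>"]) (auto simp: antipodal_chains_def singular_chain_of)
next
  case (Suc m)
  then obtain h where h: "antipodal_chains (nsphere n) uminus m h"
    and h0: "h 0 = frag_of \<sigma>"
    using Suc_leD by blast
  define c where "c = h m + frag_cmul ((-1) ^ Suc m) (chain_map m uminus (h m))"
  have hm: "singular_chain m (nsphere n) (h m)"
    using h by (simp add: antipodal_chains_def)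
  have "\<exists>d. singular_chain (Suc m) (nsphere n) d \<and> chain_boundary (Suc m) d = c"
  proof (cases m)
    case 0
    show ?thesis
    proof -
      obtain d where "singular_chain (Suc 0) (nsphere n) d" 
        "chain_boundary (Suc 0) d = frag_of \<sigma> - frag_of (simplex_map 0 uminus \<sigma>)"
        by (rule antipodal_points_bound [OF _ \<sigma>]) (use Suc.prems in auto)
      then show ?thesis
        using 0 by (intro exI [of _ d]) (simp add: c_def h0)
    qed
  next
    case (Suc m')
    define b where "b = chain_boundary m (h m)"
    have b: "b = h m' + frag_cmul ((-1) ^ m) (chain_map m' uminus (h m'))"
      using h Suc by (simp add: b_def antipodal_chains_def)
    have m': "singular_chain m' (nsphere n) (h m')"
      using h Suc by (simp add: antipodal_chains_def)
    have cc: "chain_map m' uminus (chain_map m' uminus (h m')) = h m'"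
      using fun_cong [OF chain_map_compose [of m' uminus uminus], of "h m'"]
       chain_map_id_gen [OF m', of "uminus \<circ> uminus"] by (simp add: fun_eq_iff)
    have "chain_boundary m c = b + frag_cmul ((-1) ^ Suc m) (chain_map m' uminus b)"
      using chain_boundary_chain_map [OF hm, of uminus] Suc
      by (simp add: c_def chain_boundary_add chain_boundary_diff chain_boundary_cmul b_def)
    also have "\<dots> = h m' + frag_cmul ((-1) ^ m) (chain_map m' uminus (h m'))
        + (frag_cmul ((-1) ^ Suc m) (chain_map m' uminus (h m')) 
        + frag_cmul ((-1) ^ Suc m * (-1) ^ m) (h m'))"
      unfolding b chain_map_add chain_map_cmul cc frag_cmul_distrib2 frag_cmul_cmul by simp
    also have "\<dots> = 0"
      by (simp flip: power_add frag_cmul_distrib)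
    finally have "chain_boundary m c = 0" .
    moreover have "singular_chain m (nsphere n) c"
      unfolding c_def
      by (intro singular_chain_add singular_chain_cmul hm singular_chain_chain_map [OF hm] continuous_map_nsphere_uminus)
    ultimately show ?thesis
      using nsphere_cycle_bounds [of m n c] Suc Suc.prems by (metis Suc_le_eq zero_less_Suc)
  qed
  then obtain d where d: "singular_chain (Suc m) (nsphere n) d" "chain_boundary (Suc m) d = c"
    by blast
  have "antipodal_chains (nsphere n) uminus (Suc m) (h(Suc m := d))"
    using h d by (auto simp: antipodal_chains_def c_def less_Suc_eq le_Suc_eq)
  moreover have "(h(Suc m := d)) 0 = frag_of \<sigma>"
    using h0 by simp
  ultimately show ?case by blast
qed

text \<open>
  The functions \<open>s i\<close> are the signs of the components of \<open>\<phi>\<close>. Where a component vanishes its sign is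
  replaced by that of the first nonzero component, because the parity argument needs functions that are
  complementary at every pair of antipodes; on small simplices this choice is never visible.
\<close>

theorem Borsuk_Ulam_nsphere:
  assumes cont: "continuous_map (nsphere n) (Euclidean_space h) \<phi>" 
    and odd: "\<And>x. x \<in> topspace (nsphere n) \<Longrightarrow> \<phi> (- x) = - \<phi> x"
    and "h \<le> n"
  obtains x where "x \<in> topspace (nsphere n)" "\<phi> x = (\<lambda>_. 0)"
proof (rule ccontr)
  assume "\<not> thesis"
  with that have nz: "\<phi> x \<noteq> (\<lambda>_. 0)" if "x \<in> topspace (nsphere n)" for x
    using that by blast
  define X where "X = nsphere n"
  obtain c where c: "antipodal_chains X uminus n c"
  proof -
    define \<sigma> :: "(nat \<Rightarrow> real) \<Rightarrow> nat \<Rightarrow> real" 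
      where "\<sigma> = restrict (\<lambda>_. simplex_vertex 0) (standard_simplex 0)"
    have "singular_simplex 0 (nsphere n) \<sigma>"
      using in_topspace_nsphere [of n] by (auto simp: \<sigma>_def singular_simplex_def continuous_map_const)
    moreover have "\<sigma> (simplex_vertex 0) = simplex_vertex 0"
      by (simp add: \<sigma>_def)
    ultimately show thesis
      using that antipodal_chains_nsphere [of n \<sigma> n] unfolding X_def by blast
  qed
  define U where "U = (\<lambda>i (\<epsilon>::real). {x \<in> topspace X. \<epsilon> * \<phi> x i > 0})"
  have nz': "\<exists>i<h. \<phi> x i \<noteq> 0" if "x \<in> topspace X" for x
  proof -
    have "\<phi> x i = 0" if "i \<ge> h" for i
      using continuous_map_image_subset_topspace [OF cont] \<open>x \<in> topspace X\<close> that
      by (auto simp: topspace_Euclidean_space X_def)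
    then show ?thesis
      using nz [of x] that by (metis X_def ext not_le)
  qed
  have contU: "continuous_map X euclideanreal (\<lambda>x. \<epsilon> * \<phi> x i)" for i \<epsilon>
    using cont unfolding Euclidean_space_def continuous_map_in_subtopology continuous_map_componentwise_UNIV X_def
    by (auto intro: continuous_intros)
  define \<U> where "\<U> = {U i \<epsilon> |i \<epsilon>. i < h \<and> \<epsilon> \<in> {1,-1}}"
  have "openin X W" if "W \<in> \<U>" for W
  proof -
    from that obtain i \<epsilon> where W: "W = U i \<epsilon>"
      unfolding \<U>_def by (elim CollectE exE conjE) simp
    have "openin X {x \<in> topspace X. \<epsilon> * \<phi> x i \<in> {0<..}}"
      by (rule openin_continuous_map_preimage [OF contU]) auto
    then show ?thesis 
      by (simp add: W U_def)
  qed
  moreover have "topspace X \<subseteq> \<Union>\<U>"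
  proof
    fix x assume x: "x \<in> topspace X"
    then obtain i where i: "i < h" "\<phi> x i \<noteq> 0" 
      using nz' by blast
    define \<epsilon> :: real where "\<epsilon> = (if \<phi> x i > 0 then 1 else -1)"
    have "x \<in> U i \<epsilon>"
      using x i by (simp add: U_def \<epsilon>_def)
    moreover have "U i \<epsilon> \<in> \<U>"
      unfolding \<U>_def using i by (intro CollectI exI [of _ i] exI [of _ \<epsilon>]) (simp add: \<epsilon>_def)
    ultimately show "x \<in> \<Union>\<U>" by (rule UnionI [rotated])
  qed
  moreover have "singular_chain h X (c h)"
    using c \<open>h \<le> n\<close> by (simp add: antipodal_chains_def)
  ultimately obtain m where m: "\<And>k f. m \<le> k \<Longrightarrow> f \<in> Poly_Mapping.keys ((singular_subdivision h ^^ k) (c h)) \<Longrightarrow> 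
      \<exists>V \<in> \<U>. f \<in> standard_simplex h \<rightarrow> V"
    using sufficient_iterated_singular_subdivision_exists [of \<U> X h "c h"] by metis
  \<comment> \<open>Index of the first nonzero component; it is the same for \<open>x\<close> and \<open>- x\<close>.\<close>
  define lead where "lead = (\<lambda>x. LEAST i. \<phi> x i \<noteq> 0)"
  define s :: "nat \<Rightarrow> (nat \<Rightarrow> real) \<Rightarrow> int" 
    where "s = (\<lambda>i x. of_bool (\<phi> x (if \<phi> x i \<noteq> 0 then i else lead x) > 0))"
  have "s i (- x) = 1 - s i x" if "x \<in> topspace X" for i x
  proof -
    have "\<exists>i. \<phi> x i \<noteq> 0" using nz' [OF that] by blast
    then have "\<phi> x (lead x) \<noteq> 0"
      unfolding lead_def by (rule LeastI_ex)
    moreover have neg: "\<phi> (- x) j = - \<phi> x j" for j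
      using odd [of x] that by (simp add: X_def)
    moreover have "lead (- x) = lead x"
      unfolding lead_def neg by simp
    ultimately show ?thesis
      by (auto simp: s_def)
  qed
  then have "odd (cochain_eval (cup_flips s h) ((singular_subdivision h ^^ m) (c h)))"
    using odd_cup_flips_antipodal_chains [OF antipodal_chains_subdivision [OF c]] \<open>h \<le> n\<close> by blast
  moreover have "cochain_eval (cup_flips s h) ((singular_subdivision h ^^ m) (c h)) = 0"
  proof (rule cochain_eval_eq_0)
    fix \<sigma> assume "\<sigma> \<in> Poly_Mapping.keys ((singular_subdivision h ^^ m) (c h))"
    then obtain W where "W \<in> \<U>" and W: "\<sigma> \<in> standard_simplex h \<rightarrow> W"
      using m [OF order_refl] by metis
    then obtain i \<epsilon> where i: "i < h" "\<epsilon> \<in> {1, -1}" and "W = U i \<epsilon>"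
      unfolding \<U>_def by (elim CollectE exE conjE)
    then have \<sigma>: "\<sigma> \<in> standard_simplex h \<rightarrow> U i \<epsilon>"
      using W by simp
    have "\<sigma> (simplex_vertex i) \<in> U i \<epsilon>" "\<sigma> (simplex_vertex (Suc i)) \<in> U i \<epsilon>"
      using \<sigma> i by (auto simp: Pi_iff)
    then have "s i (\<sigma> (simplex_vertex (Suc i))) - s i (\<sigma> (simplex_vertex i)) = 0"
      using i by (auto simp: s_def U_def of_bool_def)
    then show "cup_flips s h \<sigma> = 0"
      unfolding cup_flips_def using i by (meson finite_lessThan lessThan_iff prod_zero)
  qed
  ultimately show False by simp
qed

section \<open>The Krasnoselskii genus\<close>

text \<open>
  Real components can be restricted, extended and symmetrized separately, without keeping track
  of a target space.
\<close>

lemma odd_map_to_iff_components: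
  "(\<exists>\<phi>. odd_map_to A h \<phi>) \<longleftrightarrow>
   (\<exists>\<Phi>::nat \<Rightarrow> ('a \<Rightarrow> real) \<Rightarrow> real.
      (\<forall>i<h. continuous_on A (\<Phi> i) \<and> (\<forall>f\<in>A. \<Phi> i (- f) = - \<Phi> i f)) \<and> (\<forall>f\<in>A. \<exists>i<h. \<Phi> i f \<noteq> 0))"
proof
  assume "\<exists>\<phi>. odd_map_to A h \<phi>"
  then obtain \<phi> where "odd_map_to A h \<phi>" by blast
  then have \<phi>: "continuous_map (top_of_set A) (Euclidean_space h) \<phi>"
    and odd: "\<And>f. f \<in> A \<Longrightarrow> \<phi> (- f) = - \<phi> f" and "\<phi> ` A \<subseteq> - {\<lambda>_. 0}"
    by (auto simp: odd_map_to_def continuous_map_in_subtopology)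
  then have nz: "\<phi> f \<noteq> (\<lambda>_. 0)" if "f \<in> A" for f
    using that by blast
  have "continuous_on A (\<lambda>f. \<phi> f i)" for i
    using \<phi> unfolding Euclidean_space_def continuous_map_in_subtopology continuous_map_componentwise_UNIV
    by simp
  moreover have "\<exists>i<h. \<phi> f i \<noteq> 0" if "f \<in> A" for f
  proof -
    have "\<phi> f i = 0" if "i \<ge> h" for i
      using \<phi> \<open>f \<in> A\<close> that by (auto simp: continuous_map_def topspace_Euclidean_space)
    then show ?thesis
      using nz [OF that] by (meson ext not_le_imp_less)
  qed
  ultimately show "\<exists>\<Phi>::nat \<Rightarrow> ('a \<Rightarrow> real) \<Rightarrow> real. (\<forall>i<h. continuous_on A (\<Phi> i) \<and> (\<forall>f\<in>A. \<Phi> i (- f) = - \<Phi> i f)) \<and> 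
      (\<forall>f\<in>A. \<exists>i<h. \<Phi> i f \<noteq> 0)"
    using odd by (intro exI [of _ "\<lambda>i f. \<phi> f i"]) auto
next
  assume "\<exists>\<Phi>::nat \<Rightarrow> ('a \<Rightarrow> real) \<Rightarrow> real. (\<forall>i<h. continuous_on A (\<Phi> i) \<and> (\<forall>f\<in>A. \<Phi> i (- f) = - \<Phi> i f)) \<and> 
      (\<forall>f\<in>A. \<exists>i<h. \<Phi> i f \<noteq> 0)"
  then obtain \<Phi> :: "nat \<Rightarrow> ('a \<Rightarrow> real) \<Rightarrow> real" 
    where \<Phi>: "\<And>i. i < h \<Longrightarrow> continuous_on A (\<Phi> i)" "\<And>i f. i < h \<Longrightarrow> f \<in> A \<Longrightarrow> \<Phi> i (- f) = - \<Phi> i f"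
      and nz: "\<And>f. f \<in> A \<Longrightarrow> \<exists>i<h. \<Phi> i f \<noteq> 0"
    by blast
  define \<phi> where "\<phi> = (\<lambda>f i. if i < h then \<Phi> i f else 0)"
  have "continuous_map (top_of_set A) (Euclidean_space h) \<phi>"
    unfolding \<phi>_def using \<Phi> by (subst continuous_map_componentwise_Euclidean_space) auto
  moreover have "\<phi> f \<noteq> (\<lambda>_. 0)" if f: "f \<in> A" for f
  proof -
    obtain i where "i < h" "\<Phi> i f \<noteq> 0" using nz [OF f] by blast
    then have "\<phi> f i \<noteq> 0" by (simp add: \<phi>_def)
    then show ?thesis by auto
  qed
  moreover have "\<phi> (- f) = - \<phi> f" if "f \<in> A" for f
    using \<Phi> that by (auto simp: \<phi>_def)
  ultimately have "odd_map_to A h \<phi>"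
    by (auto simp: odd_map_to_def continuous_map_in_subtopology)
  then show "\<exists>\<phi>. odd_map_to A h \<phi>" by blast
qed

text \<open>
  The case distinction in the definition of the genus disappears in this form: on the empty set there
  is an odd map even to the empty space \<open>\<real>\<^sup>0 \<setminus> {0}\<close>.
\<close>

lemma genus_less_iff:
  assumes "0 < k"
  shows "genus A < enat k \<longleftrightarrow> (\<exists>h<k. \<exists>\<phi>. odd_map_to A h \<phi>)"
proof (cases "A = {}")
  case True
  then have "\<exists>\<phi>. odd_map_to A 0 \<phi>"
    unfolding odd_map_to_iff_components by simp
  then show ?thesis
    using True assms by (auto simp: genus_def zero_enat_def)
next
  case False
  show ?thesis
  proof (cases "\<exists>h \<phi>. odd_map_to A h \<phi>")
    case True
    then have "\<exists>\<phi>. odd_map_to A (LEAST h. \<exists>\<phi>. odd_map_to A h \<phi>) \<phi>"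
      by (rule LeastI_ex)
    then show ?thesis
      using False True by (auto simp: genus_def intro: Least_le le_less_trans)
  qed (use False in \<open>auto simp: genus_def\<close>)
qed

lemma genus_mono:
  assumes "A \<subseteq> A'" 
  shows "genus A \<le> genus A'"
proof (rule ccontr)
  assume "\<not> ?thesis"
  then have less: "genus A' < genus A" by simp
  then obtain k where k: "genus A' = enat k"
    by (cases "genus A'") auto
  then have "genus A' < enat (Suc k)" by simp
  then obtain h where "h < Suc k" "\<exists>\<phi>. odd_map_to A' h \<phi>"
    by (auto simp: genus_less_iff)
  then have "\<exists>\<phi>. odd_map_to A h \<phi>"
    unfolding odd_map_to_iff_components
    by (elim ex_forward) (use assms in \<open>blast intro: continuous_on_subset\<close>)
  then have "genus A < enat (Suc k)"
    using \<open>h < Suc k\<close> by (subst genus_less_iff) auto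
  then show False 
    using less k by (cases "genus A") auto
qed

lemma genus_ge_sphere:
  assumes cont: "continuous_map (nsphere n) euclidean g"
    and odd: "\<And>x. x \<in> topspace (nsphere n) \<Longrightarrow> g (- x) = - g x"
    and A: "\<And>x. x \<in> topspace (nsphere n) \<Longrightarrow> g x \<in> A"
  shows "genus A \<ge> enat (Suc n)"
proof (rule ccontr)
  assume "\<not> ?thesis"
  then obtain h \<phi> where h: "h < Suc n" and \<phi>: "odd_map_to A h \<phi>"
    using genus_less_iff [of "Suc n" A] by auto
  have "continuous_map (nsphere n) (top_of_set A) g"
    using cont A by (auto simp: continuous_map_in_subtopology)
  moreover have "continuous_map (top_of_set A) (Euclidean_space h) \<phi>"
    using \<phi> by (simp add: odd_map_to_def continuous_map_in_subtopology)
  ultimately have "continuous_map (nsphere n) (Euclidean_space h) (\<phi> \<circ> g)"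
    by (rule continuous_map_compose)
  moreover have "(\<phi> \<circ> g) (- x) = - (\<phi> \<circ> g) x" if "x \<in> topspace (nsphere n)" for x
    using odd [OF that] A [OF that] \<phi> by (simp add: odd_map_to_def)
  ultimately obtain x where "x \<in> topspace (nsphere n)" "\<phi> (g x) = (\<lambda>_. 0)"
    using Borsuk_Ulam_nsphere [of n h "\<phi> \<circ> g"] h by auto
  moreover have "\<phi> ` A \<subseteq> - {\<lambda>_. 0}"
    using \<phi> by (auto simp: odd_map_to_def continuous_map_in_subtopology)
  ultimately show False
    using A by blast
qed

lemma uminus_uminus_fun: "- (- f) = (f :: 'a \<Rightarrow> real)"
  by (simp add: fun_eq_iff)

lemma Hausdorff_euclidean_fun: "Hausdorff_space (euclidean :: ('a \<Rightarrow> real) topology)"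
  unfolding euclidean_product_topology [symmetric]
  by (simp add: Hausdorff_space_product_topology)

text \<open>
  Extend an odd map without zeros on the sublevel set of \<open>c\<close> to all of \<open>S\<close> by Tietze, and restore oddness
  by averaging. Its zeros form a compact set on which \<open>\<rho>\<close> exceeds \<open>c\<close>, hence exceeds some
  \<open>c' > c\<close>; below \<open>c'\<close> the extension still has no zeros.
\<close>

lemma genus_sublevel_upper_semicontinuous:
  fixes S :: "('a \<Rightarrow> real) set" and \<rho> :: "('a \<Rightarrow> real) \<Rightarrow> real"
  assumes S: "compact S" "uminus ` S = S" and \<rho>: "continuous_on S \<rho>" 
    and even: "\<And>f. f \<in> S \<Longrightarrow> \<rho> (- f) = \<rho> f"
    and k: "0 < k" "genus {f \<in> S. \<rho> f \<le> c} < enat k"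
  obtains c' where "c < c'" "genus {f \<in> S. \<rho> f \<le> c'} < enat k"
proof -
  have sym: "- f \<in> S" if "f \<in> S" for f
    using S(2) that by blast
  obtain h \<Phi> where "h < k" and raw:
    "\<forall>i<h. continuous_on {f \<in> S. \<rho> f \<le> c} (\<Phi> i) \<and> (\<forall>f\<in>{f \<in> S. \<rho> f \<le> c}. \<Phi> i (- f) = - \<Phi> i f)"
    "\<forall>f\<in>{f \<in> S. \<rho> f \<le> c}. \<exists>i<h. \<Phi> i f \<noteq> (0::real)"
    using k unfolding genus_less_iff [OF k(1)] odd_map_to_iff_components by (elim exE conjE)
  then have \<Phi>: "i < h \<Longrightarrow> continuous_on {f \<in> S. \<rho> f \<le> c} (\<Phi> i)"
    "i < h \<Longrightarrow> f \<in> S \<Longrightarrow> \<rho> f \<le> c \<Longrightarrow> \<Phi> i (- f) = - \<Phi> i f"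
    "f \<in> S \<Longrightarrow> \<rho> f \<le> c \<Longrightarrow> \<exists>i<h. \<Phi> i f \<noteq> 0"
    for i f by auto
  have normal: "normal_space (top_of_set S)"
    using S(1) 
    by (intro compact_Hausdorff_or_regular_imp_normal_space)
       (auto simp: compact_space_subtopology compactin_euclidean_iff Hausdorff_space_subtopology Hausdorff_euclidean_fun)
  have "closedin (top_of_set S) (S \<inter> \<rho> -` {..c})"
    by (rule continuous_closedin_preimage [OF \<rho>]) auto
  then have closed: "closedin (top_of_set S) {f \<in> S. \<rho> f \<le> c}"
    by (simp add: vimage_def Int_def)
  have "\<exists>g. continuous_on S g \<and> (\<forall>f\<in>S. \<rho> f \<le> c \<longrightarrow> g f = \<Phi> i f)" if i: "i < h" for i
  proof -
    have "subtopology (top_of_set S) {f \<in> S. \<rho> f \<le> c} = top_of_set {f \<in> S. \<rho> f \<le> c}"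
      by (simp add: subtopology_subtopology Int_absorb1 subset_iff)
    then obtain g where "continuous_map (top_of_set S) euclideanreal g" 
      "\<And>f. f \<in> {f \<in> S. \<rho> f \<le> c} \<Longrightarrow> g f = \<Phi> i f"
      using Tietze_extension_realinterval [OF normal closed, of UNIV "\<Phi> i"] \<Phi>(1) [OF i] by auto
    then show ?thesis by auto
  qed
  then obtain G where G: "\<And>i. i < h \<Longrightarrow> continuous_on S (G i)" 
    "\<And>i f. i < h \<Longrightarrow> f \<in> S \<Longrightarrow> \<rho> f \<le> c \<Longrightarrow> G i f = \<Phi> i f"
    by metis
  \<comment> \<open>Tietze does not preserve oddness, but where \<open>\<rho> f \<le> c\<close> the odd part of \<open>G i\<close> is still \<open>\<Phi> i\<close>.\<close>
  define \<Psi> where "\<Psi> = (\<lambda>i f. (G i f - G i (- f)) / 2)"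
  have cont_neg: "continuous_on S (uminus :: ('a \<Rightarrow> real) \<Rightarrow> _)"
    unfolding fun_Compl_def 
    by (intro continuous_on_coordinatewise_then_product continuous_intros continuous_on_subset [OF continuous_on_product_coordinates]) auto
  have cont: "continuous_on S (\<Psi> i)" if "i < h" for i
  proof -
    have "continuous_on S (\<lambda>f. G i (- f))"
      using continuous_on_compose2 [OF G(1) [OF that] cont_neg] S(2) by auto
    then show ?thesis
      unfolding \<Psi>_def using G(1) [OF that] by (intro continuous_intros) auto
  qed
  have odd: "\<Psi> i (- f) = - \<Psi> i f" for i f
    by (simp add: \<Psi>_def field_simps uminus_uminus_fun)
  have nz: "\<exists>i<h. \<Psi> i f \<noteq> 0" if f: "f \<in> S" "\<rho> f \<le> c" for f
  proof -
    obtain i where i: "i < h" "\<Phi> i f \<noteq> 0" using \<Phi>(3) f by blast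
    have "\<Psi> i f = \<Phi> i f"
      using G(2) [OF i(1)] \<Phi>(2) [OF i(1)] f sym even by (simp add: \<Psi>_def)
    then show ?thesis using i by auto
  qed
  define Z where "Z = {f \<in> S. (\<Sum>i<h. \<bar>\<Psi> i f\<bar>) = 0}"
  have Z: "f \<in> Z \<longleftrightarrow> f \<in> S \<and> (\<forall>i<h. \<Psi> i f = 0)" for f
    by (auto simp: Z_def sum_nonneg_eq_0_iff)
  have "continuous_on S (\<lambda>f. \<Sum>i<h. \<bar>\<Psi> i f\<bar>)"
    using cont by (intro continuous_intros) auto
  then have "closedin (top_of_set S) (S \<inter> (\<lambda>f. \<Sum>i<h. \<bar>\<Psi> i f\<bar>) -` {0})"
    by (rule continuous_closedin_preimage) auto
  then have "closedin (top_of_set S) Z"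
    by (simp add: Z_def vimage_def Int_def)
  then have "compact Z"
    using S(1) by (metis closedin_compact)
  have "\<exists>c'>c. \<forall>f\<in>Z. c' < \<rho> f"
  proof (cases "Z = {}")
    case True
    then show ?thesis by (auto intro: exI [of _ "c + 1"])
  next
    case False
    then obtain z where z: "z \<in> Z" "\<And>f. f \<in> Z \<Longrightarrow> \<rho> z \<le> \<rho> f"
      using continuous_attains_inf [OF \<open>compact Z\<close>, of \<rho>] continuous_on_subset [OF \<rho>, of Z] Z by blast
    have "c < \<rho> z"
      using nz [of z] z(1) Z [of z] by force
    then obtain c' where "c < c'" "c' < \<rho> z" using dense by blast
    then show ?thesis using z(2) by force
  qed
  then obtain c' where c': "c < c'" "\<And>f. f \<in> Z \<Longrightarrow> c' < \<rho> f" by blast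
  have "\<exists>\<phi>. odd_map_to {f \<in> S. \<rho> f \<le> c'} h \<phi>"
    unfolding odd_map_to_iff_components
  proof (intro exI [of _ \<Psi>] conjI allI impI ballI)
    show "continuous_on {f \<in> S. \<rho> f \<le> c'} (\<Psi> i)" if "i < h" for i
      using cont [OF that] by (rule continuous_on_subset) auto
    show "\<exists>i<h. \<Psi> i f \<noteq> 0" if "f \<in> {f \<in> S. \<rho> f \<le> c'}" for f
      using that c'(2) [of f] Z [of f] by auto
  qed (use odd in auto)
  then have "genus {f \<in> S. \<rho> f \<le> c'} < enat k"
    using \<open>h < k\<close> genus_less_iff [OF k(1)] by blast
  then show thesis using that c' by blast
qed

section \<open>The variational eigenvalues as levels of the gradient norm\<close>

lemma continuous_on_Max_image:
  fixes g :: "'i \<Rightarrow> 'b::topological_space \<Rightarrow> real"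
  assumes "finite I" "I \<noteq> {}" "\<And>i. i \<in> I \<Longrightarrow> continuous_on S (g i)"
  shows "continuous_on S (\<lambda>x. Max ((\<lambda>i. g i x) ` I))"
  using assms
proof (induction I rule: finite_ne_induct)
  case (insert i I)
  have "Max ((\<lambda>i. g i x) ` insert i I) = max (g i x) (Max ((\<lambda>i. g i x) ` I))" for x
    using insert.hyps by simp
  then show ?case
    using insert by (simp add: continuous_on_max)
qed simp

context weighted_graph
begin

lemma finite_E: "finite E"
  using finite_V E_subset by (meson finite_SigmaI finite_subset)

lemma V_nonempty: "V \<noteq> {}"
  using internal_nonempty by blast

lemma abs_le_norm_inf: "u \<in> V \<Longrightarrow> \<bar>f u\<bar> \<le> norm_inf f"
  unfolding norm_inf_def using finite_V by (intro Max_ge) auto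

lemma norm_inf_attained: "\<exists>u\<in>V. \<bar>f u\<bar> = norm_inf f"
proof -
  have "norm_inf f \<in> (\<lambda>u. \<bar>f u\<bar>) ` V"
    unfolding norm_inf_def using finite_V V_nonempty by (intro Max_in) auto
  then show ?thesis by force
qed

lemma norm_inf_eqI:
  assumes "\<And>u. u \<in> V \<Longrightarrow> \<bar>f u\<bar> \<le> c" "u \<in> V" "\<bar>f u\<bar> = c"
  shows "norm_inf f = c"
  using assms norm_inf_attained [of f] abs_le_norm_inf [of u f] by force

lemma grad_le_grad_norm_inf: "(u, v) \<in> E \<Longrightarrow> \<bar>grad f u v\<bar> \<le> grad_norm_inf f"
  unfolding grad_norm_inf_def using finite_E by (auto intro!: Max_ge)

lemma grad_norm_inf_nonneg: "grad_norm_inf f \<ge> 0"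
proof (cases "E = {}")
  case False
  then obtain u v where "(u, v) \<in> E" by auto
  then show ?thesis using grad_le_grad_norm_inf [of u v f] by linarith
qed (unfold grad_norm_inf_def, simp)

lemma grad_norm_inf_le:
  assumes "\<And>u v. (u, v) \<in> E \<Longrightarrow> \<bar>grad f u v\<bar> \<le> c" "c \<ge> 0"
  shows "grad_norm_inf f \<le> c"
  unfolding grad_norm_inf_def using finite_E assms by auto

lemma norm_inf_uminus: "norm_inf (- f) = norm_inf f"
  by (simp add: norm_inf_def)

lemma grad_norm_inf_uminus: "grad_norm_inf (- f) = grad_norm_inf f"
proof -
  have "\<bar>grad (- f) u v\<bar> = \<bar>grad f u v\<bar>" for u v
    unfolding grad_def abs_mult uminus_apply by (simp add: abs_minus_commute)
  then show ?thesis by (simp add: grad_norm_inf_def)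
qed

lemma rayleigh_inf_S_inf: "f \<in> S_inf \<Longrightarrow> rayleigh_inf f = grad_norm_inf f"
  by (simp add: S_inf_def rayleigh_inf_def)

lemma uminus_S_inf: "f \<in> S_inf \<Longrightarrow> - f \<in> S_inf"
  by (simp add: S_inf_def H0_def norm_inf_uminus)

lemma continuous_on_coordinate: "continuous_on S (\<lambda>f :: 'a \<Rightarrow> real. f u)"
  by (rule continuous_on_subset [OF continuous_on_product_coordinates]) simp

lemma continuous_on_norm_inf: "continuous_on S norm_inf"
  unfolding norm_inf_def using finite_V V_nonempty
  by (intro continuous_on_Max_image continuous_intros continuous_on_coordinate)

lemma continuous_on_grad_norm_inf: "continuous_on S grad_norm_inf"
proof (cases "E = {}")
  case False
  have "continuous_on S (\<lambda>f. Max ((\<lambda>e. (\<lambda>(u, v). \<bar>grad f u v\<bar>) e) ` E))"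
    by (intro continuous_on_Max_image finite_E False)
       (auto simp: grad_def split_beta intro!: continuous_intros continuous_on_coordinate)
  then show ?thesis
    unfolding grad_norm_inf_def using False by simp
qed (unfold grad_norm_inf_def, simp)

lemma closed_S_inf: "closed S_inf"
proof -
  have "S_inf = (\<Inter>u\<in>B \<union> - V. {f. f u = 0}) \<inter> {f. norm_inf f = 1}"
    by (auto simp: S_inf_def H0_def)
  moreover have "closed {f :: 'a \<Rightarrow> real. f u = 0}" for u
    by (intro closed_Collect_eq continuous_on_coordinate continuous_on_const)
  moreover have "closed {f. norm_inf f = 1}"
    by (intro closed_Collect_eq continuous_on_norm_inf continuous_on_const)
  ultimately show ?thesis
    by (metis (lifting) closed_INT closed_Int)
qed

lemma compact_S_inf: "compact S_inf"
proof -
  define K where "K = (\<Pi>\<^sub>E u\<in>UNIV. if u \<in> V then {-1..1::real} else {0})"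
  have "compactin (product_topology (\<lambda>_. euclideanreal) UNIV) K"
    unfolding K_def by (auto simp: compactin_PiE)
  then have "compact K"
    by (simp add: euclidean_product_topology compactin_euclidean_iff)
  moreover have "S_inf \<subseteq> K"
  proof
    fix f assume f: "f \<in> S_inf"
    have "f u \<in> (if u \<in> V then {-1..1} else {0})" for u
      using f abs_le_norm_inf [of u f] by (auto simp: S_inf_def H0_def abs_le_iff)
    then show "f \<in> K" unfolding K_def by (intro PiE_I) auto
  qed
  ultimately show ?thesis
    using closed_S_inf by (metis Int_absorb1 compact_Int_closed)
qed

text \<open>
  These are the sublevel sets of the Rayleigh quotient, since its denominator is \<open>1\<close> on \<open>S_inf\<close>.
\<close>

definition sublevel :: "real \<Rightarrow> ('a \<Rightarrow> real) set" where
  "sublevel c = {f \<in> S_inf. grad_norm_inf f \<le> c}"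

lemma sublevel_genus_family:
  assumes "genus (sublevel c) \<ge> enat k"
  shows "sublevel c \<in> genus_family k"
proof -
  have "closed (S_inf \<inter> {f. grad_norm_inf f \<le> c})"
    by (intro closed_Int closed_S_inf closed_Collect_le continuous_on_grad_norm_inf continuous_on_const)
  then have "closed (sublevel c)"
    by (simp add: sublevel_def Int_def)
  moreover have neg: "- f \<in> sublevel c" if "f \<in> sublevel c" for f
    using that by (simp add: sublevel_def uminus_S_inf grad_norm_inf_uminus)
  then have "uminus ` sublevel c = sublevel c"
    by (force simp: image_iff intro: uminus_uminus_fun [symmetric])
  ultimately show ?thesis
    using assms by (auto simp: genus_family_def sublevel_def)
qed

lemma max_rayleigh_attained:
  assumes A: "A \<in> genus_family k" and "0 < k"
  shows "\<exists>f\<in>A. max_rayleigh A = grad_norm_inf f" "\<And>f. f \<in> A \<Longrightarrow> grad_norm_inf f \<le> max_rayleigh A"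
proof -
  have sub: "A \<subseteq> S_inf" "closed A" and gen: "genus A \<ge> enat k"
    using A by (auto simp: genus_family_def)
  have "A \<noteq> {}"
    using gen \<open>0 < k\<close> by (auto simp: genus_def zero_enat_def)
  moreover have "compact A"
    using sub compact_S_inf by (metis Int_absorb1 compact_Int_closed)
  ultimately obtain f where f: "f \<in> A" "\<And>g. g \<in> A \<Longrightarrow> grad_norm_inf g \<le> grad_norm_inf f"
    using continuous_attains_sup [OF _ _ continuous_on_grad_norm_inf] by metis
  have "max_rayleigh A = grad_norm_inf f"
    unfolding max_rayleigh_def
    by (rule Greatest_equality) (use f sub in \<open>auto simp: rayleigh_inf_S_inf subset_iff\<close>)
  then show "\<exists>f\<in>A. max_rayleigh A = grad_norm_inf f" "\<And>f. f \<in> A \<Longrightarrow> grad_norm_inf f \<le> max_rayleigh A"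
    using f by auto
qed

text \<open>
  The witness is the sublevel set of the least level at which the genus reaches \<open>k\<close>. Both claims
  concern a value defined by \<open>LEAST\<close>, so the level \<open>c\<close> in the hypothesis is what makes the competition
  nonempty.
\<close>

lemma Lambda_attained:
  assumes "0 < k" and c: "genus (sublevel c) \<ge> enat k"
  shows "\<exists>A\<in>genus_family k. Lambda k = max_rayleigh A" "Lambda k \<le> c"
proof -
  define C where "C = {c. genus (sublevel c) \<ge> enat k}"
  define m where "m = Inf C"
  have nonneg: "0 \<le> d" if "d \<in> C" for d
  proof -
    have "sublevel d \<noteq> {}"
      using that \<open>0 < k\<close> by (auto simp: C_def genus_def zero_enat_def)
    then show ?thesis
      using grad_norm_inf_nonneg by (force simp: sublevel_def intro: order_trans)
  qed
  have bdd: "bdd_below C"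
    using nonneg by (rule bdd_belowI)
  have m_le: "m \<le> d" if "d \<in> C" for d
    unfolding m_def using that bdd by (rule cInf_lower)
  have "m \<in> C"
  proof (rule ccontr)
    assume "m \<notin> C"
    then have gen: "genus {f \<in> S_inf. grad_norm_inf f \<le> m} < enat k"
      by (simp add: C_def sublevel_def)
    have sym: "uminus ` S_inf = S_inf"
      using uminus_S_inf by (force simp: image_iff intro: uminus_uminus_fun [symmetric])
    obtain c' where c': "m < c'" "genus (sublevel c') < enat k"
      unfolding sublevel_def
      by (rule genus_sublevel_upper_semicontinuous [OF compact_S_inf sym continuous_on_grad_norm_inf
            grad_norm_inf_uminus \<open>0 < k\<close> gen])
    have "c \<in> C" using c by (simp add: C_def)
    then obtain d where d: "d \<in> C" "d < c'"
      using c'(1) unfolding m_def by (metis cInf_lessD empty_iff)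
    have "genus (sublevel d) \<le> genus (sublevel c')"
      using d(2) by (intro genus_mono) (auto simp: sublevel_def)
    also have "\<dots> < enat k" by (rule c'(2))
    finally show False
      using d(1) by (simp add: C_def)
  qed
  have upper: "max_rayleigh A \<in> C" if A: "A \<in> genus_family k" for A
  proof -
    have "A \<subseteq> sublevel (max_rayleigh A)"
      using A max_rayleigh_attained(2) [OF A \<open>0 < k\<close>] by (auto simp: sublevel_def genus_family_def)
    moreover have "genus A \<ge> enat k"
      using A by (simp add: genus_family_def)
    ultimately show ?thesis
      using genus_mono order_trans unfolding C_def by blast
  qed
  have sub: "sublevel m \<in> genus_family k"
    using \<open>m \<in> C\<close> by (auto simp: C_def intro: sublevel_genus_family)
  have "max_rayleigh (sublevel m) \<le> m"
    using max_rayleigh_attained(1) [OF sub \<open>0 < k\<close>] by (auto simp: sublevel_def)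
  then have max: "max_rayleigh (sublevel m) = m"
    using upper [OF sub] m_le by force
  have "Lambda k = m"
    unfolding Lambda_def
  proof (rule Least_equality)
    show "\<exists>A\<in>genus_family k. m = max_rayleigh A"
      using sub max by metis
    show "m \<le> l" if "\<exists>A\<in>genus_family k. l = max_rayleigh A" for l
      using that upper m_le by blast
  qed
  then show "\<exists>A\<in>genus_family k. Lambda k = max_rayleigh A" 
    using sub max by metis
  show "Lambda k \<le> c"
    using \<open>Lambda k = m\<close> m_le c by (simp add: C_def)
qed

section \<open>Walks and distances\<close>

text \<open>
  Walks record only the two ends and the length of a path, which is all that distances depend on.
\<close>

inductive walk :: "'a \<Rightarrow> real \<Rightarrow> 'a \<Rightarrow> bool" where
  walk_refl: "walk u 0 u"
| walk_step: "(u, x) \<in> E \<Longrightarrow> walk x l v \<Longrightarrow> walk u (inverse (\<omega> u x) + l) v"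

lemma path_length_Cons: "path_length (x # y # ys) = inverse (\<omega> x y) + path_length (y # ys)"
  by (simp add: path_length_def sum.lessThan_Suc_shift del: sum.lessThan_Suc)

lemma walk_iff_node_path: "walk u l v \<longleftrightarrow> (\<exists>xs. node_path E u xs v \<and> l = path_length xs)"
proof
  assume "walk u l v"
  then show "\<exists>xs. node_path E u xs v \<and> l = path_length xs"
  proof induction
    case (walk_refl u)
    show ?case
      by (intro exI [of _ "[u]"]) (simp add: node_path_def path_length_def)
  next
    case (walk_step u x l v)
    then obtain ys where ys: "node_path E x (x # ys) v" "l = path_length (x # ys)"
      by (metis node_path_def list.collapse)
    then show ?case
      using walk_step.hyps
      by (intro exI [of _ "u # x # ys"]) (auto simp: node_path_def path_length_Cons)
  qed
next
  assume "\<exists>xs. node_path E u xs v \<and> l = path_length xs"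
  then obtain xs where "node_path E u xs v" "l = path_length xs" by blast
  then show "walk u l v"
  proof (induction xs arbitrary: u l)
    case Nil
    then show ?case by (simp add: node_path_def)
  next
    case (Cons x xs)
    show ?case
    proof (cases xs)
      case Nil
      then show ?thesis
        using Cons.prems by (auto simp: node_path_def path_length_def intro: walk_refl)
    next
      case (Cons y ys)
      then have "node_path E y xs v" "(x, y) \<in> E" "u = x"
        using Cons.prems by (auto simp: node_path_def)
      then show ?thesis
        using Cons.IH [of y "path_length xs"] Cons.prems Cons by (auto simp: path_length_Cons intro: walk_step)
    qed
  qed
qed

lemma inverse_weight_pos: "(u, v) \<in> E \<Longrightarrow> inverse (\<omega> u v) > 0"
  by (simp add: weight_pos)

lemma edge_sym: "(u, v) \<in> E \<Longrightarrow> (v, u) \<in> E"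
  using sym_E by (meson symE)

lemma walk_nonneg: "walk u l v \<Longrightarrow> l \<ge> 0"
  by (induction rule: walk.induct) (auto intro: add_nonneg_nonneg less_imp_le inverse_weight_pos)

lemma walk_append: "walk u l v \<Longrightarrow> walk v m w \<Longrightarrow> walk u (l + m) w"
  by (induction rule: walk.induct) (auto simp: add.assoc intro: walk_step)

lemma walk_edge: "(u, v) \<in> E \<Longrightarrow> walk u (inverse (\<omega> u v)) v"
  using walk_step [OF _ walk_refl] by simp

lemma walk_sym: "walk u l v \<Longrightarrow> walk v l u"
proof (induction rule: walk.induct)
  case (walk_step u x l v)
  then show ?case
    using walk_append [OF walk_step.IH walk_edge [OF edge_sym]] weight_sym [OF walk_step.hyps(1)]
    by (simp add: add.commute)
qed (rule walk_refl)

lemma walk_in_V: "walk u l v \<Longrightarrow> u \<in> V \<Longrightarrow> v \<in> V"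
  by (induction rule: walk.induct) (use E_subset in auto)

text \<open>
  All edges have length at least some \<open>\<delta> > 0\<close>, so a walk of bounded length has boundedly many edges. Hence
  the length of a shortest walk is a minimum although there are infinitely many walks.
\<close>

lemma finite_walk_lengths: "finite {l. walk u l v \<and> l \<le> L}"
proof -
  define \<delta> where "\<delta> = Min (insert 1 ((\<lambda>(u, v). inverse (\<omega> u v)) ` E))"
  have "\<delta> \<in> insert 1 ((\<lambda>(u, v). inverse (\<omega> u v)) ` E)"
    unfolding \<delta>_def using finite_E by (intro Min_in) auto
  then have "\<delta> > 0"
    using inverse_weight_pos by auto
  have \<delta>_le: "\<delta> \<le> inverse (\<omega> u v)" if "(u, v) \<in> E" for u v
    unfolding \<delta>_def using finite_E that by (intro Min_le) auto
  have fin: "finite {l. walk u l v \<and> l \<le> real n * \<delta>}" for n u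
  proof (induction n arbitrary: u)
    case 0
    have "{l. walk u l v \<and> l \<le> real 0 * \<delta>} \<subseteq> {0}"
      using walk_nonneg by force
    then show ?case
      by (rule finite_subset) simp
  next
    case (Suc n)
    have "{l. walk u l v \<and> l \<le> real (Suc n) * \<delta>} \<subseteq> 
        insert 0 (\<Union>x\<in>V. (\<lambda>l. inverse (\<omega> u x) + l) ` {l. walk x l v \<and> l \<le> real n * \<delta>})"
    proof
      fix l assume "l \<in> {l. walk u l v \<and> l \<le> real (Suc n) * \<delta>}"
      then have "walk u l v" and l: "l \<le> real (Suc n) * \<delta>" by auto
      then show "l \<in> insert 0 (\<Union>x\<in>V. (\<lambda>l. inverse (\<omega> u x) + l) ` {l. walk x l v \<and> l \<le> real n * \<delta>})"
      proof cases
        case (walk_step x l')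
        have "l' \<le> real n * \<delta>"
          using l \<delta>_le [OF walk_step(2)] walk_step(1) by (simp add: algebra_simps)
        then show ?thesis
          using walk_step E_subset by blast
      qed simp
    qed
    then show ?case
      by (rule finite_subset) (use Suc finite_V in auto)
  qed
  obtain n where "L / \<delta> \<le> real n" using real_arch_simple by blast
  then have "L \<le> real n * \<delta>" using \<open>\<delta> > 0\<close> by (simp add: field_simps)
  then show ?thesis
    by (intro finite_subset [OF _ fin [of u n]]) auto
qed

lemma shortest_walk:
  assumes "walk u l v"
  obtains m where "walk u m v" "dist_G u v = ereal m" "\<And>l. walk u l v \<Longrightarrow> m \<le> l"
proof -
  define W where "W = {l'. walk u l' v \<and> l' \<le> l}"
  define m where "m = Min W"
  have W: "finite W" "l \<in> W"
    using assms finite_walk_lengths by (auto simp: W_def)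
  have "m \<in> W"
    unfolding m_def using W by (intro Min_in) auto
  then have m: "walk u m v" "m \<le> l"
    by (auto simp: W_def)
  have le: "m \<le> l'" if "walk u l' v" for l'
  proof (cases "l' \<le> l")
    case True
    then show ?thesis unfolding m_def using W that by (intro Min_le) (auto simp: W_def)
  qed (use m in auto)
  have "(LEAST l. \<exists>xs. node_path E u xs v \<and> l = path_length xs) = m"
    unfolding walk_iff_node_path [symmetric] using m le by (intro Least_equality)
  moreover have "\<exists>xs. node_path E u xs v"
    using assms walk_iff_node_path by blast
  ultimately have "dist_G u v = ereal m"
    by (simp add: dist_G_def)
  then show thesis using that m le by blast
qed

lemma dist_G_infinity: "(\<And>l. \<not> walk u l v) \<Longrightarrow> dist_G u v = \<infinity>"
  unfolding walk_iff_node_path by (auto simp: dist_G_def)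

lemma dist_G_le: "walk u l v \<Longrightarrow> dist_G u v \<le> ereal l"
  using shortest_walk by (metis ereal_less_eq(3))

lemma dist_G_walk:
  assumes "dist_G u v \<noteq> \<infinity>"
  obtains l where "walk u l v" "dist_G u v = ereal l"
  using assms dist_G_infinity shortest_walk by metis

lemma dist_G_ge: "(\<And>l. walk u l v \<Longrightarrow> c \<le> ereal l) \<Longrightarrow> c \<le> dist_G u v"
  by (metis dist_G_walk ereal_less_eq(1))

lemma dist_G_sym: "dist_G u v = dist_G v u"
proof -
  have "dist_G x y \<le> dist_G y x" for x y
    by (rule dist_G_ge) (rule dist_G_le, erule walk_sym)
  then show ?thesis by (intro order_antisym)
qed

lemma dist_G_pos:
  assumes "u \<noteq> v" 
  shows "dist_G u v > 0"
proof (cases "dist_G u v = \<infinity>")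
  case False
  then obtain l where "walk u l v" and d: "dist_G u v = ereal l"
    using dist_G_walk by blast
  from this(1) assms have "l > 0"
    by cases (auto intro: add_pos_nonneg inverse_weight_pos walk_nonneg)
  then show ?thesis using d by simp
qed simp

lemma finite_B: "finite B"
  using finite_V B_subset by (rule rev_finite_subset)

lemma dist_B_empty: "B = {} \<Longrightarrow> dist_B u = \<infinity>"
  unfolding dist_B_def by simp

lemma dist_B_le: "b \<in> B \<Longrightarrow> dist_B u \<le> dist_G u b"
  unfolding dist_B_def using finite_B by auto

lemma dist_B_attained:
  assumes "B \<noteq> {}"
  obtains b where "b \<in> B" "dist_B u = dist_G u b"
proof -
  have "Min (dist_G u ` B) \<in> dist_G u ` B"
    using assms finite_B by (intro Min_in) auto
  then have "dist_B u \<in> dist_G u ` B"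
    unfolding dist_B_def using assms by simp
  then show thesis using that by blast
qed

lemma dist_B_pos: 
  assumes "u \<notin> B"
  shows "dist_B u > 0"
proof (cases "B = {}")
  case False
  then obtain b where "b \<in> B" "dist_B u = dist_G u b" by (rule dist_B_attained)
  then show ?thesis using assms dist_G_pos by metis
qed (unfold dist_B_def, simp)

lemma internal_walk:
  assumes "u \<in> V - B" "v \<in> V - B"
  obtains l where "walk u l v"
proof -
  have "connected_within E (V - B)"
    using connected_no_boundary connected_internal by (cases "B = {}") auto
  then obtain xs where "node_path E u xs v"
    using assms unfolding connected_within_def by blast
  then show thesis using that walk_iff_node_path by blast
qed

lemma dist_B_finite:
  assumes "B \<noteq> {}" "u \<in> V - B"
  shows "dist_B u \<noteq> \<infinity>"
proof -
  obtain a b where a: "a \<in> V - B" and b: "b \<in> B" "(a, b) \<in> E"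
    using adjacent_boundary [OF assms(1)] by blast
  obtain l where "walk u l a" using internal_walk assms(2) a by blast
  then have "walk u (l + inverse (\<omega> a b)) b"
    using walk_append walk_edge b by blast
  then have "dist_B u \<le> ereal (l + inverse (\<omega> a b))"
    using dist_G_le dist_B_le [OF b(1)] order_trans by blast
  then show ?thesis by auto
qed

text \<open>
  The definition of the gradient makes \<open>f\<close> Lipschitz for the path metric, with its gradient norm
  as constant.
\<close>

lemma lipschitz_walk: "walk u l v \<Longrightarrow> \<bar>f v - f u\<bar> \<le> grad_norm_inf f * l"
proof (induction rule: walk.induct)
  case (walk_step u x l v)
  have "\<bar>f x - f u\<bar> * \<omega> u x \<le> grad_norm_inf f"
    using grad_le_grad_norm_inf [OF walk_step(1), of f] weight_pos [OF walk_step(1)]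
    by (simp add: grad_def abs_mult mult.commute)
  then have "\<bar>f x - f u\<bar> \<le> grad_norm_inf f * inverse (\<omega> u x)"
    using weight_pos [OF walk_step(1)] by (simp add: field_simps)
  then show ?case
    using walk_step.IH by (simp add: algebra_simps)
qed simp

section \<open>Packing radii\<close>

definition packing :: "nat \<Rightarrow> real \<Rightarrow> (nat \<Rightarrow> 'a) \<Rightarrow> bool" where
  "packing k r u \<longleftrightarrow> 
     (\<forall>i\<in>{1..k}. u i \<in> V - B) \<and>
     (\<forall>i\<in>{1..k}. \<forall>j\<in>{1..k}. i \<noteq> j \<longrightarrow> dist_G (u i) (u j) \<ge> ereal (2 * r)) \<and>
     (\<forall>i\<in>{1..k}. dist_B (u i) \<ge> ereal r)"

lemma packable_iff_packing: "packable k r \<longleftrightarrow> (\<exists>u. packing k r u)"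
  by (simp add: packable_def packing_def)

definition half_dist :: "'a \<Rightarrow> 'a \<Rightarrow> ereal" where
  "half_dist x y = dist_G x y / 2"

lemma ereal_le_half_dist_iff: "ereal r \<le> half_dist x y \<longleftrightarrow> ereal (2 * r) \<le> dist_G x y"
  unfolding half_dist_def by (cases "dist_G x y") auto

lemma half_dist_infinity_iff: "half_dist x y = \<infinity> \<longleftrightarrow> dist_G x y = \<infinity>"
  unfolding half_dist_def by (cases "dist_G x y") auto

lemma half_dist_pos: "x \<noteq> y \<Longrightarrow> half_dist x y > 0"
  using dist_G_pos [of x y] unfolding half_dist_def by (cases "dist_G x y") auto

lemma half_dist_nonneg: "half_dist x y \<ge> 0"
proof -
  have "0 \<le> dist_G x y"
    by (rule dist_G_ge) (use walk_nonneg in \<open>simp add: zero_ereal_def\<close>)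
  then show ?thesis unfolding half_dist_def by (cases "dist_G x y") auto
qed

text \<open>
  A packing that is as wide as its centres permit is limited by half a distance between centres or by a
  distance to the boundary. These finitely many values contain every finite packing radius.
\<close>

definition packing_values :: "real set" where
  "packing_values = real_of_ereal ` ((\<lambda>(x, y). half_dist x y) ` (V \<times> V) \<union> dist_B ` V)"

lemma finite_packing_values: "finite packing_values"
  using finite_V by (simp add: packing_values_def)

text \<open>
  For fixed centres the largest radius is the minimum \<open>m\<close> of all constraints. Connectedness makes
  at least one of them finite, except for a single centre in a graph without boundary.
\<close>

lemma optimal_packing:
  assumes u: "\<And>i. i \<in> {1..k} \<Longrightarrow> u i \<in> V - B" and k: "1 \<le> k" "\<not> (B = {} \<and> k = 1)"
  obtains R where "R \<in> packing_values" "packing k R u" "\<And>r. packing k r u \<Longrightarrow> r \<le> R" 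
    "inj_on u {1..k} \<Longrightarrow> R > 0"
proof -
  define C where "C = {half_dist (u i) (u j) |i j. i \<in> {1..k} \<and> j \<in> {1..k} \<and> i \<noteq> j} \<union> {dist_B (u i) |i. i \<in> {1..k}}"
  define m where "m = Min C"
  have packing_iff: "packing k r u \<longleftrightarrow> (\<forall>c\<in>C. ereal r \<le> c)" for r
  proof -
    have "(\<forall>c\<in>C. ereal r \<le> c) \<longleftrightarrow>
        (\<forall>i\<in>{1..k}. \<forall>j\<in>{1..k}. i \<noteq> j \<longrightarrow> ereal r \<le> half_dist (u i) (u j)) \<and> (\<forall>i\<in>{1..k}. ereal r \<le> dist_B (u i))"
      unfolding C_def by blast
    then show ?thesis
      using u by (simp add: packing_def ereal_le_half_dist_iff)
  qed
  have "C \<subseteq> (\<lambda>(i, j). half_dist (u i) (u j)) ` ({1..k} \<times> {1..k}) \<union> (\<lambda>i. dist_B (u i)) ` {1..k}"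
    unfolding C_def by auto
  then have "finite C"
    by (rule finite_subset) auto
  moreover have "dist_B (u 1) \<in> C"
    using k unfolding C_def by auto
  ultimately have C: "finite C" "C \<noteq> {}" by auto
  have m_in: "m \<in> C" and m_le: "\<And>c. c \<in> C \<Longrightarrow> m \<le> c"
    unfolding m_def using C by (auto intro: Min_in)
  have "\<exists>c\<in>C. c \<noteq> \<infinity>"
  proof (cases "B = {}")
    case True
    then have k2: "1 \<in> {1..k}" "2 \<in> {1..k}" using k by auto
    obtain l where "walk (u 1) l (u 2)" using internal_walk u k2 by blast
    then have "dist_G (u 1) (u 2) \<noteq> \<infinity>" using dist_G_le by fastforce
    then have "half_dist (u 1) (u 2) \<noteq> \<infinity>" by (simp add: half_dist_infinity_iff)
    moreover have "half_dist (u 1) (u 2) \<in> C" 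
      unfolding C_def using k2 by (intro UnI1 CollectI exI [of _ 1] exI [of _ 2]) auto
    ultimately show ?thesis by blast
  next
    case False
    have "dist_B (u 1) \<noteq> \<infinity>" using dist_B_finite [OF False] u k by auto
    then show ?thesis using \<open>dist_B (u 1) \<in> C\<close> by blast
  qed
  then have "m \<noteq> \<infinity>" using m_le by fastforce
  moreover have "0 \<le> c" if "c \<in> C" for c
    using that half_dist_nonneg u unfolding C_def by (auto intro!: less_imp_le [OF dist_B_pos])
  then have "0 \<le> m" using m_in by blast
  ultimately obtain R where R: "m = ereal R"
    by (cases m) auto
  show thesis
  proof
    have "m \<in> (\<lambda>(x, y). half_dist x y) ` (V \<times> V) \<union> dist_B ` V"
      using m_in u by (fastforce simp: C_def)
    then show "R \<in> packing_values"
      unfolding packing_values_def by (rule rev_image_eqI) (simp add: R)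
    show "packing k R u"
      using m_le by (simp add: packing_iff R)
    show "r \<le> R" if "packing k r u" for r
      using that m_in by (auto simp: packing_iff R)
    show "R > 0" if "inj_on u {1..k}"
    proof -
      have "0 < c" if "c \<in> C" for c
        using that \<open>inj_on u {1..k}\<close> u unfolding C_def by (auto intro!: half_dist_pos dist_B_pos dest: inj_onD)
      then show ?thesis using m_in R by fastforce
    qed
  qed
qed

lemma packing_radius_attained:
  assumes k: "1 \<le> k" "k \<le> card (V - B)" "\<not> (B = {} \<and> k = 1)"
  obtains R where "packing_radius k = ereal R" "R > 0" "packable k R" 
    "\<And>r. packable k r \<Longrightarrow> r \<le> R"
proof -
  obtain h where h: "bij_betw h {1..card (V - B)} (V - B)"
    using ex_bij_betw_nat_finite_1 finite_V by blast
  then have "h i \<in> V - B" if "i \<in> {1..k}" for i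
    using that k(2) bij_betwE by fastforce
  moreover have "inj_on h {1..k}"
    using h k(2) by (auto simp: bij_betw_def intro: inj_on_subset)
  ultimately obtain R0 where R0: "R0 \<in> packing_values" "packing k R0 h" "R0 > 0"
    using optimal_packing [of k h] k by metis
  define Q where "Q = {r \<in> packing_values. packable k r}"
  define R where "R = Max Q"
  have Q: "finite Q" "R0 \<in> Q"
    using R0 finite_packing_values by (auto simp: Q_def packable_iff_packing)
  have "R \<in> Q"
    unfolding R_def using Q by (intro Max_in) auto
  then have "packable k R" by (simp add: Q_def)
  have "R0 \<le> R"
    unfolding R_def using Q by (intro Max_ge)
  have max: "r \<le> R" if r: "packable k r" for r
  proof -
    obtain u where u: "packing k r u" using r by (auto simp: packable_iff_packing)
    then have "\<And>i. i \<in> {1..k} \<Longrightarrow> u i \<in> V - B" by (simp add: packing_def)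
    then obtain R' where R': "R' \<in> packing_values" "packing k R' u" "r \<le> R'"
      using optimal_packing [of k u] k(1,3) u by metis
    then have "R' \<le> R"
      unfolding R_def using Q by (intro Max_ge) (auto simp: Q_def packable_iff_packing)
    then show ?thesis using R' by simp
  qed
  have "(GREATEST r. r > 0 \<and> packable k r) = R"
    using \<open>R0 \<le> R\<close> R0(3) \<open>packable k R\<close> max by (intro Greatest_equality) auto
  then have "packing_radius k = ereal R"
    unfolding packing_radius_def using k(3) by auto
  then show thesis
    using that \<open>R0 \<le> R\<close> R0(3) \<open>packable k R\<close> max by force
qed

section \<open>Packings bound the eigenvalues from above\<close>

text \<open>
  The tent \<open>max 0 (1 - d(c, x) / r)\<close>, written so that an infinite distance causes no trouble.
\<close>

definition bump :: "real \<Rightarrow> 'a \<Rightarrow> 'a \<Rightarrow> real" where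
  "bump r c x = (if dist_G c x < ereal r then 1 - real_of_ereal (dist_G c x) / r else 0)"

lemma bump_self: "0 < r \<Longrightarrow> bump r c c = 1"
proof -
  assume "0 < r"
  obtain m where "walk c m c" "dist_G c c = ereal m" "\<And>l. walk c l c \<Longrightarrow> m \<le> l"
    using shortest_walk [OF walk_refl] by metis
  then have "dist_G c c = 0"
    using walk_refl [of c] walk_nonneg by (metis antisym zero_ereal_def)
  then show ?thesis using \<open>0 < r\<close> by (simp add: bump_def)
qed

lemma bump_walk:
  assumes "0 < r" "bump r c x \<noteq> 0"
  obtains l where "walk c l x" "dist_G c x = ereal l" "l < r" "bump r c x = 1 - l / r"
proof -
  have less: "dist_G c x < ereal r"
    using assms by (auto simp: bump_def split: if_splits)
  then have "dist_G c x \<noteq> \<infinity>" by auto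
  then obtain l where "walk c l x" "dist_G c x = ereal l"
    by (rule dist_G_walk)
  then show thesis
    using that less by (simp add: bump_def)
qed

lemma bump_nonneg: 
  assumes "0 < r"
  shows "0 \<le> bump r c x"
proof (cases "bump r c x = 0")
  case False
  then obtain l where "l < r" "bump r c x = 1 - l / r"
    using bump_walk assms by metis
  then show ?thesis using assms by simp
qed simp

lemma bump_le_1: 
  assumes "0 < r"
  shows "bump r c x \<le> 1"
proof (cases "bump r c x = 0")
  case False
  then obtain l where "walk c l x" "bump r c x = 1 - l / r"
    using bump_walk assms by metis
  then show ?thesis using walk_nonneg assms by simp
qed simp

lemma bump_ge:
  assumes "0 < r" "walk c l x"
  shows "1 - l / r \<le> bump r c x"
proof (cases "bump r c x = 0")
  case True
  obtain m where m: "dist_G c x = ereal m" "m \<le> l"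
    using shortest_walk [OF assms(2)] assms(2) by metis
  have "r \<le> m"
  proof (rule ccontr)
    assume "\<not> r \<le> m"
    then have "bump r c x = 1 - m / r" "m / r < 1"
      using m assms(1) by (auto simp: bump_def)
    then show False using True by simp
  qed
  then have "1 \<le> l / r" using m assms(1) by simp
  then show ?thesis using True by simp
next
  case False
  then obtain m where m: "dist_G c x = ereal m" "bump r c x = 1 - m / r"
    using bump_walk assms(1) by metis
  have "m \<le> l" using dist_G_le [OF assms(2)] m by simp
  then show ?thesis using m assms(1) by (simp add: divide_right_mono)
qed

lemma bump_outside: "0 < r \<Longrightarrow> c \<in> V \<Longrightarrow> x \<notin> V \<Longrightarrow> bump r c x = 0"
  using bump_walk walk_in_V by metis

lemma bump_boundary: "0 < r \<Longrightarrow> dist_B c \<ge> ereal r \<Longrightarrow> x \<in> B \<Longrightarrow> bump r c x = 0"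
  using dist_B_le [of x c] by (auto simp: bump_def dest: order_trans)

lemma bump_edge:
  assumes "0 < r" "(x, y) \<in> E"
  shows "\<bar>bump r c x - bump r c y\<bar> \<le> inverse (\<omega> x y) / r"
proof -
  have *: "bump r c x \<le> bump r c y + inverse (\<omega> x y) / r" if e: "(x, y) \<in> E" for x y
  proof (cases "bump r c x = 0")
    case True
    then show ?thesis
      using bump_nonneg [OF assms(1), of c y] inverse_weight_pos [OF e] assms(1) by simp
  next
    case False
    then obtain l where l: "walk c l x" "bump r c x = 1 - l / r"
      using bump_walk assms(1) by metis
    have "1 - (l + inverse (\<omega> x y)) / r \<le> bump r c y"
      by (rule bump_ge [OF assms(1) walk_append [OF l(1) walk_edge [OF e]]])
    then show ?thesis using l by (simp add: add_divide_distrib)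
  qed
  show ?thesis
    using * [OF assms(2)] * [OF edge_sym [OF assms(2)]] weight_sym [OF assms(2)] by (simp add: abs_le_iff)
qed

text \<open>
  The walks from \<open>c\<close> to \<open>x\<close>, on to \<open>y\<close> and back to \<open>d\<close> together have length at least \<open>2 * r\<close>. For \<open>m = 0\<close> this
  shows that the supports of two tents are disjoint; for an edge from \<open>x\<close> to \<open>y\<close> it bounds the
  gradient between two supports.
\<close>

lemma bump_far:
  assumes "0 < r" "ereal (2 * r) \<le> dist_G c d" "walk x m y" "bump r c x \<noteq> 0" "bump r d y \<noteq> 0"
  shows "bump r c x + bump r d y \<le> m / r"
proof -
  obtain l where l: "walk c l x" "bump r c x = 1 - l / r"
    using bump_walk assms by metis
  obtain l' where l': "walk d l' y" "bump r d y = 1 - l' / r"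
    using bump_walk assms by metis
  have "walk c ((l + m) + l') d"
    using walk_append [OF walk_append [OF l(1) assms(3)] walk_sym [OF l'(1)]] .
  then have "2 * r \<le> l + m + l'"
    using dist_G_le assms(2) by (metis ereal_less_eq(3) order_trans)
  then show ?thesis
    using assms(1) l l' by (simp add: field_simps)
qed

definition bump_comb :: "nat \<Rightarrow> real \<Rightarrow> (nat \<Rightarrow> 'a) \<Rightarrow> (nat \<Rightarrow> real) \<Rightarrow> 'a \<Rightarrow> real" where
  "bump_comb k r u a x = (\<Sum>i\<in>{1..k}. a i * bump r (u i) x)"

text \<open>
  At each node at most one tent is nonzero. The sup norm is therefore that of the coefficients. Across
  an edge, a change within one support is bounded by the slope of its tent, and a change between two
  supports, where the coefficients may have opposite signs, by \<open>bump_far\<close>.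
\<close>

lemma bump_comb_sublevel:
  assumes r: "0 < r" and u: "packing k r u" 
    and a: "\<And>i. i \<in> {1..k} \<Longrightarrow> \<bar>a i\<bar> \<le> 1" "\<exists>i\<in>{1..k}. \<bar>a i\<bar> = 1"
  shows "bump_comb k r u a \<in> sublevel (1 / r)"
proof -
  define f where "f = bump_comb k r u a"
  have uV: "u i \<in> V" and uB: "dist_B (u i) \<ge> ereal r" if "i \<in> {1..k}" for i
    using u that by (auto simp: packing_def)
  have far: "ereal (2 * r) \<le> dist_G (u i) (u j)" if "i \<in> {1..k}" "j \<in> {1..k}" "i \<noteq> j" for i j
    using u that by (auto simp: packing_def)
  have one: "f x = a i * bump r (u i) x" if i: "i \<in> {1..k}" "bump r (u i) x \<noteq> 0" for i x
  proof -
    \<comment> \<open>Two active tents at the same node would be joined by a walk of length \<open>0\<close>.\<close>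
    have zero: "bump r (u j) x = 0" if j: "j \<in> {1..k}" "j \<noteq> i" for j
    proof (rule ccontr)
      assume "bump r (u j) x \<noteq> 0"
      then have "bump r (u i) x + bump r (u j) x \<le> 0 / r"
        using bump_far [OF r far walk_refl] i j by metis
      then show False
        using bump_nonneg [OF r] i \<open>bump r (u j) x \<noteq> 0\<close> by (smt (verit) div_0)
    qed
    have "f x = (\<Sum>j\<in>{1..k}. if j = i then a i * bump r (u i) x else 0)"
      unfolding f_def bump_comb_def by (rule sum.cong) (use zero in auto)
    then show ?thesis using i(1) by simp
  qed
  have none: "f x = 0" if "\<And>i. i \<in> {1..k} \<Longrightarrow> bump r (u i) x = 0" for x
    using that by (simp add: f_def bump_comb_def)
  have abs_bump: "\<bar>a i * t\<bar> \<le> \<bar>t\<bar>" if "i \<in> {1..k}" for i t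
    using a(1) [OF that] by (simp add: abs_mult mult_left_le_one_le)
  have abs_le: "\<bar>f x\<bar> \<le> 1" for x
  proof (cases "\<forall>i\<in>{1..k}. bump r (u i) x = 0")
    case True
    then show ?thesis using none by simp
  next
    case False
    then obtain i where i: "i \<in> {1..k}" "bump r (u i) x \<noteq> 0" by blast
    then have "\<bar>f x\<bar> \<le> \<bar>bump r (u i) x\<bar>"
      using one abs_bump by metis
    then show ?thesis
      using bump_nonneg [OF r, of "u i" x] bump_le_1 [OF r, of "u i" x] by linarith
  qed
  obtain i where i: "i \<in> {1..k}" "\<bar>a i\<bar> = 1" using a(2) by blast
  have "\<bar>f (u i)\<bar> = 1"
    using one [OF i(1), of "u i"] bump_self [OF r, of "u i"] i(2) by simp
  then have "norm_inf f = 1"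
    using abs_le uV [OF i(1)] by (intro norm_inf_eqI)
  moreover have "f \<in> H0"
    using none bump_outside [OF r uV] bump_boundary [OF r uB] by (auto simp: H0_def)
  ultimately have S: "f \<in> S_inf" by (simp add: S_inf_def)
  have edge: "\<bar>f y - f x\<bar> \<le> inverse (\<omega> x y) / r" if e: "(x, y) \<in> E" for x y
  proof -
    have half: "\<bar>f y - f x\<bar> \<le> inverse (\<omega> x y) / r" 
      if e: "(x, y) \<in> E" and i: "i \<in> {1..k}" "bump r (u i) x \<noteq> 0" for x y i
    proof (cases "\<exists>j\<in>{1..k}. j \<noteq> i \<and> bump r (u j) y \<noteq> 0")
      case True
      then obtain j where j: "j \<in> {1..k}" "j \<noteq> i" "bump r (u j) y \<noteq> 0" by blast
      have "\<bar>f y - f x\<bar> \<le> \<bar>f x\<bar> + \<bar>f y\<bar>" by simp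
      also have "\<dots> \<le> \<bar>bump r (u i) x\<bar> + \<bar>bump r (u j) y\<bar>"
        unfolding one [OF i] one [OF j(1,3)] using abs_bump i(1) j(1) by (intro add_mono) auto
      also have "\<dots> = bump r (u i) x + bump r (u j) y"
        using bump_nonneg [OF r] by simp
      also have "\<dots> \<le> inverse (\<omega> x y) / r"
        using bump_far [OF r far walk_edge [OF e] i(2) j(3)] i(1) j by metis
      finally show ?thesis .
    next
      case False
      have "f y = a i * bump r (u i) y"
      proof (cases "bump r (u i) y = 0")
        case True
        then have "bump r (u j) y = 0" if "j \<in> {1..k}" for j
          using False that by (cases "j = i") auto
        then show ?thesis using none True by simp
      qed (rule one [OF i(1)])
      then have "\<bar>f y - f x\<bar> = \<bar>a i * (bump r (u i) x - bump r (u i) y)\<bar>"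
        unfolding one [OF i] by (simp add: right_diff_distrib abs_minus_commute)
      also have "\<dots> \<le> \<bar>bump r (u i) x - bump r (u i) y\<bar>"
        using i(1) by (rule abs_bump)
      also have "\<dots> \<le> inverse (\<omega> x y) / r"
        by (rule bump_edge [OF r e])
      finally show ?thesis .
    qed
    show ?thesis
    proof (cases "\<exists>i\<in>{1..k}. bump r (u i) x \<noteq> 0 \<or> bump r (u i) y \<noteq> 0")
      case True
      then show ?thesis
        using half [OF e] half [OF edge_sym [OF e]] weight_sym [OF e] by (metis abs_minus_commute)
    next
      case False
      then have "f x = 0" "f y = 0" using none by auto
      then show ?thesis using inverse_weight_pos [OF e] r by simp
    qed
  qed
  have "grad_norm_inf f \<le> 1 / r"
  proof (rule grad_norm_inf_le)
    show "\<bar>grad f x y\<bar> \<le> 1 / r" if e: "(x, y) \<in> E" for x y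
    proof -
      have "\<bar>grad f x y\<bar> = \<omega> x y * \<bar>f y - f x\<bar>"
        using weight_pos [OF e] by (simp add: grad_def abs_mult)
      also have "\<dots> \<le> \<omega> x y * (inverse (\<omega> x y) / r)"
        using edge [OF e] weight_pos [OF e] by (intro mult_left_mono) auto
      also have "\<dots> = 1 / r"
        using weight_pos [OF e] by simp
      finally show ?thesis .
    qed
  qed (use r in simp)
  then show ?thesis
    using S by (simp add: sublevel_def f_def)
qed

text \<open>
  Radial projection of the round sphere onto the boundary of the cube turns its points into coefficient
  vectors of maximum norm one, and the tents turn these into functions in the sublevel set.
\<close>

lemma genus_sublevel_packing:
  assumes r: "0 < r" and "packable k r" and "1 \<le> k"
  shows "genus (sublevel (1 / r)) \<ge> enat k"
proof -
  obtain u where u: "packing k r u" using assms(2) by (auto simp: packable_iff_packing)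
  obtain n where n: "k = Suc n" using assms(3) by (cases k) auto
  define N :: "(nat \<Rightarrow> real) \<Rightarrow> real" where "N = (\<lambda>x. Max ((\<lambda>i. \<bar>x i\<bar>) ` {..n}))"
  \<comment> \<open>Coordinates of the sphere are numbered from \<open>0\<close>, centres of a packing from \<open>1\<close>.\<close>
  define g where "g = (\<lambda>x. bump_comb k r u (\<lambda>i. x (i - 1) / N x))"
  have N_ge: "\<bar>x i\<bar> \<le> N x" if "i \<le> n" for x i
    unfolding N_def using that by (intro Max_ge) auto
  have N_attained: "\<exists>i\<le>n. \<bar>x i\<bar> = N x" for x
  proof -
    have "N x \<in> (\<lambda>i. \<bar>x i\<bar>) ` {..n}"
      unfolding N_def by (intro Max_in) auto
    then show ?thesis by force
  qed
  have N_pos: "N x > 0" if "x \<in> topspace (nsphere n)" for x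
  proof (rule ccontr)
    assume "\<not> N x > 0"
    then have "x i = 0" if "i \<le> n" for i
      using N_ge [OF that, of x] by simp
    then have "(\<Sum>i\<le>n. (x i)\<^sup>2) = 0" by simp
    then show False using that by (simp add: nsphere)
  qed
  have top: "nsphere n = top_of_set {x. (\<Sum>i\<le>n. (x i)\<^sup>2) = 1 \<and> (\<forall>i>n. x i = 0)}" 
    unfolding nsphere by (simp add: euclidean_product_topology)
  have "enat (Suc n) \<le> genus (sublevel (1 / r))"
  proof (rule genus_ge_sphere)
    have coord: "continuous_on S (\<lambda>x :: nat \<Rightarrow> real. x i)" for S i
      by (rule continuous_on_subset [OF continuous_on_product_coordinates]) simp
    have N_cont: "continuous_on S N" for S
      unfolding N_def by (intro continuous_on_Max_image continuous_intros coord) auto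
    have "continuous_on (topspace (nsphere n)) g"
    proof (rule continuous_on_coordinatewise_then_product)
      show "continuous_on (topspace (nsphere n)) (\<lambda>x. g x v)" for v
        unfolding g_def bump_comb_def
        by (intro continuous_intros coord N_cont) (use N_pos in force)
    qed
    then show "continuous_map (nsphere n) euclidean g"
      unfolding top by simp
    show "g (- x) = - g x" if "x \<in> topspace (nsphere n)" for x
    proof -
      have "N (- x) = N x" by (simp add: N_def)
      then show ?thesis
        by (simp add: g_def bump_comb_def fun_eq_iff sum_negf)
    qed
    show "g x \<in> sublevel (1 / r)" if x: "x \<in> topspace (nsphere n)" for x
      unfolding g_def
    proof (rule bump_comb_sublevel [OF r u])
      show "\<bar>x (i - 1) / N x\<bar> \<le> 1" if "i \<in> {1..k}" for i
        using N_ge [of "i - 1" x] N_pos [OF x] that n by auto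
      obtain i where "i \<le> n" "\<bar>x i\<bar> = N x" using N_attained by blast
      then show "\<exists>i\<in>{1..k}. \<bar>x (i - 1) / N x\<bar> = 1"
        using N_pos [OF x] n by (intro bexI [of _ "Suc i"]) auto
    qed
  qed
  then show ?thesis by (simp add: n)
qed

text \<open>
  A single centre in a graph without boundary is packable with every radius. This gives \<open>Lambda 1 \<le> 0\<close>,
  in accordance with an infinite packing radius.
\<close>

lemma Lambda_le_packing:
  assumes "1 \<le> k" "k \<le> card (V - B)"
  shows "ereal (Lambda k) \<le> 1 / packing_radius k"
proof (cases "B = {} \<and> k = 1")
  case True
  obtain c where c: "c \<in> V - B" using internal_nonempty by blast
  have "packable 1 r" for r
    unfolding packable_def using c dist_B_empty [of c] True by (intro exI [of _ "\<lambda>_. c"]) simp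
  then have le: "Lambda 1 \<le> 1 / r" if "r > 0" for r
    using that by (intro Lambda_attained(2) genus_sublevel_packing) auto
  have "Lambda 1 \<le> 0"
  proof (rule field_le_epsilon)
    show "Lambda 1 \<le> 0 + e" if "0 < e" for e
      using le [of "1 / e"] that by simp
  qed
  moreover have "packing_radius k = \<infinity>"
    unfolding packing_radius_def using True by simp
  ultimately show ?thesis using True by (simp add: zero_ereal_def)
next
  case False
  then obtain R where R: "packing_radius k = ereal R" "R > 0" "packable k R"
    using packing_radius_attained assms by metis
  have "Lambda k \<le> 1 / R"
    using assms R by (intro Lambda_attained(2) genus_sublevel_packing) auto
  then show ?thesis using R by (simp add: one_ereal_def)
qed

lemma Lambda_witness:
  assumes "1 \<le> k" "k \<le> card (V - B)"
  obtains A where "A \<in> genus_family k" "Lambda k = max_rayleigh A"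
proof -
  have "\<exists>r>0. packable k r"
  proof (cases "B = {} \<and> k = 1")
    case True
    obtain c where c: "c \<in> V - B" using internal_nonempty by blast
    have "packable 1 1"
      unfolding packable_def using c dist_B_empty [of c] True by (intro exI [of _ "\<lambda>_. c"]) simp
    then show ?thesis using True zero_less_one by blast
  next
    case False
    then show ?thesis using packing_radius_attained assms by metis
  qed
  then obtain r where "0 < r" "packable k r" by blast
  then show thesis
    using that Lambda_attained(1) genus_sublevel_packing assms by (metis less_le_trans zero_less_one)
qed

section \<open>The first two eigenvalues\<close>

text \<open>
  Between a node with \<open>\<bar>f\<bar> = 1\<close> and the boundary, where \<open>f\<close> vanishes, the Lipschitz bound leaves room
  for the inverse of the gradient norm.
\<close>

lemma inverse_grad_norm_le_dist_B:
  assumes "f \<in> H0" "\<bar>f u\<bar> = 1" "B \<noteq> {}" "u \<in> V - B"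
  shows "grad_norm_inf f > 0" "ereal (1 / grad_norm_inf f) \<le> dist_B u"
proof -
  obtain b where b: "b \<in> B" "dist_B u = dist_G u b" using dist_B_attained assms(3) by blast
  then obtain l where l: "walk u l b" "dist_B u = ereal l"
    using dist_B_finite [OF assms(3,4)] dist_G_walk by metis
  have "f b = 0" using assms(1) b by (simp add: H0_def)
  then have ge: "1 \<le> grad_norm_inf f * l"
    using lipschitz_walk [OF l(1), of f] assms(2) by simp
  then show pos: "grad_norm_inf f > 0"
    using walk_nonneg [OF l(1)] grad_norm_inf_nonneg [of f] by (cases "grad_norm_inf f = 0") auto
  show "ereal (1 / grad_norm_inf f) \<le> dist_B u"
    using ge pos l by (simp add: field_simps)
qed

lemma Lambda_1_ge: "1 / packing_radius 1 \<le> ereal (Lambda 1)"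
proof -
  have card: "1 \<le> card (V - B)"
    using internal_nonempty finite_V by (simp add: Suc_le_eq card_gt_0_iff)
  obtain A where A: "A \<in> genus_family 1" "Lambda 1 = max_rayleigh A"
    using Lambda_witness [OF _ card] by auto
  obtain f where f: "f \<in> A" "Lambda 1 = grad_norm_inf f"
    using max_rayleigh_attained(1) [OF A(1)] A(2) by auto
  have "f \<in> H0" "norm_inf f = 1"
    using f A(1) by (auto simp: genus_family_def S_inf_def)
  then obtain u where u: "u \<in> V" "\<bar>f u\<bar> = 1"
    using norm_inf_attained by metis
  then have uI: "u \<in> V - B" using \<open>f \<in> H0\<close> by (auto simp: H0_def)
  show ?thesis
  proof (cases "B = {}")
    case True
    then have "packing_radius 1 = \<infinity>"
      unfolding packing_radius_def by simp
    then show ?thesis using grad_norm_inf_nonneg f by simp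
  next
    case False
    define \<rho> where "\<rho> = 1 / grad_norm_inf f"
    have \<rho>: "grad_norm_inf f > 0" "ereal \<rho> \<le> dist_B u"
      using inverse_grad_norm_le_dist_B [OF \<open>f \<in> H0\<close> u(2) False uI] by (auto simp: \<rho>_def)
    have "packable 1 \<rho>"
      unfolding packable_def using uI \<rho> by (intro exI [of _ "\<lambda>_. u"]) auto
    moreover obtain R where R: "packing_radius 1 = ereal R" "R > 0" "\<And>r. packable 1 r \<Longrightarrow> r \<le> R"
      using packing_radius_attained [of 1] card False by (metis order_refl)
    ultimately have "\<rho> \<le> R" by blast
    then have "1 / R \<le> grad_norm_inf f"
      using \<rho>(1) R(2) by (simp add: \<rho>_def field_simps)
    then show ?thesis using R f by (simp add: one_ereal_def)
  qed
qed

text \<open>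
  The function \<open>\<Phi> f = max f + min f\<close> is odd and continuous. If it had no zero on \<open>A\<close>, it would map \<open>A\<close> to
  \<open>\<real> \<setminus> {0}\<close> and the genus would be at most one. At a zero, maximum and minimum are opposite, and
  the sup norm makes them \<open>1\<close> and \<open>-1\<close>.
\<close>

lemma genus_ge_2_balanced:
  assumes A: "A \<in> genus_family 2"
  obtains f u v where "f \<in> A" "u \<in> V" "v \<in> V" "f u = 1" "f v = - 1"
proof -
  \<comment> \<open>The minimum of \<open>f\<close> is written as minus the maximum of \<open>- f\<close>.\<close>
  define \<Phi> where "\<Phi> = (\<lambda>f :: 'a \<Rightarrow> real. Max ((\<lambda>u. f u) ` V) - Max ((\<lambda>u. - f u) ` V))"
  have "\<exists>f\<in>A. \<Phi> f = 0"
  proof (rule ccontr)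
    assume "\<not> ?thesis"
    then have nz: "\<Phi> f \<noteq> 0" if "f \<in> A" for f using that by blast
    have "\<exists>\<phi>. odd_map_to A 1 \<phi>"
      unfolding odd_map_to_iff_components
    proof (intro exI [of _ "\<lambda>_. \<Phi>"] conjI allI impI ballI)
      show "continuous_on A \<Phi>"
        unfolding \<Phi>_def using finite_V V_nonempty
        by (intro continuous_intros continuous_on_Max_image continuous_on_coordinate)
      show "\<Phi> (- f) = - \<Phi> f" for f
        by (simp add: \<Phi>_def)
      show "\<exists>i<1::nat. \<Phi> f \<noteq> 0" if "f \<in> A" for f
        using nz that by auto
    qed
    then have "(1::nat) < 2 \<and> (\<exists>\<phi>. odd_map_to A 1 \<phi>)" by simp
    then have "\<exists>h<2. \<exists>\<phi>. odd_map_to A h \<phi>" by (rule exI)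
    then have "genus A < enat 2"
      by (simp only: genus_less_iff zero_less_numeral)
    then show False using A by (simp add: genus_family_def not_le [symmetric])
  qed
  then obtain f where f: "f \<in> A" "\<Phi> f = 0" by blast
  then have norm: "norm_inf f = 1"
    using A by (auto simp: genus_family_def S_inf_def)
  define M where "M = Max ((\<lambda>u. f u) ` V)"
  have M': "M = Max ((\<lambda>u. - f u) ` V)"
    using f(2) by (simp add: \<Phi>_def M_def)
  have "M \<in> (\<lambda>u. f u) ` V" 
    unfolding M_def using finite_V V_nonempty by (intro Max_in) auto
  then obtain u where u: "u \<in> V" "f u = M" by auto
  have "M \<in> (\<lambda>u. - f u) ` V" 
    unfolding M' using finite_V V_nonempty by (intro Max_in) auto
  then obtain v where v: "v \<in> V" "f v = - M" by auto
  have le: "f w \<le> M" if "w \<in> V" for w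
    unfolding M_def using that finite_V by (intro Max_ge) auto
  have ge: "- f w \<le> M" if "w \<in> V" for w
    unfolding M' using that finite_V by (intro Max_ge) auto
  have "norm_inf f = M"
    using le [OF u(1)] ge [OF u(1)] u le ge by (intro norm_inf_eqI [of f M u]) (auto simp: abs_le_iff)
  then show thesis
    using that f(1) u v norm by auto
qed

lemma Lambda_2_ge:
  assumes card: "2 \<le> card (V - B)"
  shows "1 / packing_radius 2 \<le> ereal (Lambda 2)"
proof -
  obtain A where A: "A \<in> genus_family 2" "Lambda 2 = max_rayleigh A"
    using Lambda_witness [OF _ card] by auto
  obtain f u v where f: "f \<in> A" "u \<in> V" "v \<in> V" "f u = 1" "f v = - 1"
    using genus_ge_2_balanced [OF A(1)] by blast
  have le: "grad_norm_inf f \<le> Lambda 2"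
    using max_rayleigh_attained(2) [OF A(1) _ f(1)] A(2) by simp
  have "f \<in> H0" using f A(1) by (auto simp: genus_family_def S_inf_def)
  then have uv: "u \<in> V - B" "v \<in> V - B" using f by (auto simp: H0_def)
  have dist: "2 \<le> grad_norm_inf f * l" if "walk u l v" for l
    using lipschitz_walk [OF that, of f] f by simp
  obtain l where "walk u l v" using internal_walk uv by blast
  then have pos: "grad_norm_inf f > 0"
    using dist grad_norm_inf_nonneg [of f] by (cases "grad_norm_inf f = 0") force+
  define \<rho> where "\<rho> = 1 / grad_norm_inf f"
  have d: "ereal (2 * \<rho>) \<le> dist_G u v"
    by (rule dist_G_ge) (use dist pos in \<open>simp add: \<rho>_def field_simps\<close>)
  have dB: "ereal \<rho> \<le> dist_B w" if "w \<in> {u, v}" for w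
  proof (cases "B = {}")
    case False
    then show ?thesis
      using that f uv inverse_grad_norm_le_dist_B(2) [OF \<open>f \<in> H0\<close> _ False] by (auto simp: \<rho>_def)
  qed (use dist_B_empty in auto)
  have "packable 2 \<rho>"
    unfolding packable_def
    by (rule exI [of _ "\<lambda>i. if i = 1 then u else v"]) (use uv d dB dist_G_sym [of u v] in auto)
  moreover obtain R where R: "packing_radius 2 = ereal R" "R > 0" "\<And>r. packable 2 r \<Longrightarrow> r \<le> R"
    using packing_radius_attained [of 2] card by auto
  ultimately have "\<rho> \<le> R" by blast
  then have "1 / R \<le> grad_norm_inf f"
    using pos R(2) by (simp add: \<rho>_def field_simps)
  then show ?thesis using R le by (simp add: one_ereal_def)
qed

end

theorem theorem4p2:
  fixes V :: "'a set" and E :: "('a \<times> 'a) set" and \<omega> :: "'a \<Rightarrow> 'a \<Rightarrow> real" and B :: "'a set"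
  assumes "weighted_graph V E \<omega> B"
  shows "(\<forall>k\<in>{1..card (V - B)}.
            ereal (weighted_graph.Lambda V E \<omega> B k) \<le> 1 / weighted_graph.packing_radius V E \<omega> B k)
       \<and> ereal (weighted_graph.Lambda V E \<omega> B 1) = 1 / weighted_graph.packing_radius V E \<omega> B 1
       \<and> (card (V - B) \<ge> 2 \<longrightarrow>
            ereal (weighted_graph.Lambda V E \<omega> B 2) = 1 / weighted_graph.packing_radius V E \<omega> B 2)"
proof -
  interpret weighted_graph V E \<omega> B by (fact assms)
  have "1 \<le> card (V - B)"
    using internal_nonempty finite_V by (simp add: Suc_le_eq card_gt_0_iff)
  then show ?thesis
    using Lambda_le_packing Lambda_1_ge Lambda_2_ge by (auto intro: order_antisym)
qed

end
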